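(* Let $\mathcal{H}$ be a stable ordered-union ultrafilter on $\mathrm{FIN}$ and let $\mathbb{P}(\mathcal{H})$ be the associated partial order of $\mathcal{H}$-conditions. Then $\mathbb{P}(\mathcal{H})$ is proper and $\omega^\omega$-bounding.
   Context: $\omega=\{0,1,2,\dots\}$ and each $n\in\omega$ is identified with $\{0,\dots,n-1\}$. $\mathrm{FIN}$ is the set of non-empty finite subsets of $\omega$. For $s,t\in\mathrm{FIN}$, $s<_{\mathtt{b}}t$ means $\max(s)<\min(t)$. A block sequence is a non-empty $X\subseteq\mathrm{FIN}$ linearly ordered by $<_{\mathtt{b}}$; $X(i)$ is its $i$th member in increasing order (starting from $i=0$). $\mathrm{FIN}^{[\omega]}$ is the set of infinite block sequences. For $A\subseteq\mathrm{FIN}$, $[A]$ is the set of all unions $\bigcup X$ where $X\subseteq A$ is a finite block sequence. An ultrafilter $\mathcal{H}$ on $\mathrm{FIN}$ is an ordered-union ultrafilter if for every $A\in\mathcal{H}$ there is $X\in\mathrm{FIN}^{[\omega]}$ with $[X]\in\mathcal{H}$ and $[X]\subseteq A$. It is stable if for every sequence $\langle X_n:n\in\omega\rangle$ with $X_n\in\mathrm{FIN}^{[\omega]}$ and $[X_n]\in\mathcal{H}$ for all $n$, there is $Y\in\mathrm{FIN}^{[\omega]}$ with $[Y]\in\mathcal{H}$ such that for every $n$, $Y(i)\in[X_n]$ for all but finitely many $i\in\omega$. Big sets: $\mathcal{P}(l)$ is the power set of $l$, $2^{\mathcal{P}(l)}$ the set of functions $\mathcal{P}(l)\to 2$, and $s^-=s\setminus\{\max(s)\}$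 for $s\in\mathrm{FIN}$. For $k\leq l<\omega$ and $s\in\mathrm{FIN}$ with $\max(s)=l$, a set $A\subseteq 2^{\mathcal{P}(l)}$ is $\langle k,s\rangle$-big if for every $\sigma:\mathcal{P}(k)\to 2$ there is $\tau\in A$ such that $\sigma(u)=\tau(u\cup s^-)$ for all $u\in\mathcal{P}(k)$. Trees: $\mathbb{T}=\bigcup_{l\in\omega}\prod_{k\in l}2^{\mathcal{P}(k)}$. A subtree of $\mathbb{T}$ is a subset $T\subseteq\mathbb{T}$ closed under restriction to initial segments. $\mathrm{Lev}_n(T)=\{f\in T:\operatorname{dom}(f)=n\}$ and $\operatorname{succ}_T(f)=\{\sigma: f^\frown\langle\sigma\rangle\in T\}$. The forcing: an $\mathcal{H}$-condition is a subtree $p=T_p\subseteq\mathbb{T}$ such that (1) $\emptyset\in T_p$; (2) for all $f\in T_p$ and $\operatorname{dom}(f)\leq n<\omega$ there is $g\in T_p$ with $f\subseteq g$ and $n\leq\operatorname{dom}(g)$; (3) for each $k\in\omega$, $H_{p,k}\in\mathcal{H}$, where $H_{p,k}=\{s\in\mathrm{FIN}: k\leq\max(s)\text{ and for all }f\in\mathrm{Lev}_{\max(s)}(T_p),\ \operatorname{succ}_{T_p}(f)\text{ is }\langle k,s\rangle\text{-big}\}$. $\mathbb{P}(\mathcal{H})$ is the set of $\mathcal{H}$-conditions, ordered by $q\leq p$ iff $T_q\subseteq T_p$. A forcing is $\omega^\omega$-bounding if every function $\omega\to\omega$ in the generic extension is pointwise bounded by a function $\omega\to\omega$ in the ground model.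 *)

theory Defs
  imports Main "HOL-Library.FuncSet" "HOL-Library.Sublist" "HOL-Library.Countable_Set"
begin

unbundle cardinal_syntax

section \<open>Stable ordered-union ultrafilters\<close>

definition FIN :: "nat set set" where
  "FIN = {s. finite s \<and> s \<noteq> {}}"

definition blt :: "nat set \<Rightarrow> nat set \<Rightarrow> bool" (infix "<\<^sub>b" 50) where
  "s <\<^sub>b t \<longleftrightarrow> Max s < Min t"

text \<open>Irreflexivity and transitivity of \<open><\<^sub>b\<close> on \<open>FIN\<close> are automatic, so a linear order only
  requires comparability.\<close>

definition block_seq :: "nat set set \<Rightarrow> bool" where
  "block_seq X \<longleftrightarrow> X \<noteq> {} \<and> X \<subseteq> FIN \<and> (\<forall>s\<in>X. \<forall>t\<in>X. s \<noteq> t \<longrightarrow> s <\<^sub>b t \<or> t <\<^sub>b s)"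

definition FIN_omega :: "nat set set set" where
  "FIN_omega = {X. block_seq X \<and> infinite X}"

text \<open>The \<open>i\<close>-th member of a block sequence, counting from \<open>0\<close>, is the one with exactly \<open>i\<close>
  predecessors.\<close>

definition member :: "nat set set \<Rightarrow> nat \<Rightarrow> nat set" where
  "member X i = (THE s. s \<in> X \<and> card {t \<in> X. t <\<^sub>b s} = i)"

definition unions :: "nat set set \<Rightarrow> nat set set" where
  "unions A = {\<Union>X | X. X \<subseteq> A \<and> finite X \<and> block_seq X}"

definition ultrafilter_on :: "'a set \<Rightarrow> 'a set set \<Rightarrow> bool" where
  "ultrafilter_on S H \<longleftrightarrow>
     H \<subseteq> Pow S \<and> S \<in> H \<and> {} \<notin> H \<and>
     (\<forall>A\<in>H. \<forall>B\<in>H. A \<inter> B \<in> H) \<and>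
     (\<forall>A\<in>H. \<forall>B. A \<subseteq> B \<and> B \<subseteq> S \<longrightarrow> B \<in> H) \<and>
     (\<forall>A. A \<subseteq> S \<longrightarrow> A \<in> H \<or> S - A \<in> H)"

definition ordered_union_ultrafilter :: "nat set set set \<Rightarrow> bool" where
  "ordered_union_ultrafilter H \<longleftrightarrow>
     ultrafilter_on FIN H \<and> (\<forall>A\<in>H. \<exists>X\<in>FIN_omega. unions X \<in> H \<and> unions X \<subseteq> A)"

definition stable_ordered_union_ultrafilter :: "nat set set set \<Rightarrow> bool" where
  "stable_ordered_union_ultrafilter H \<longleftrightarrow>
     ordered_union_ultrafilter H \<and>
     (\<forall>X :: nat \<Rightarrow> nat set set. (\<forall>n. X n \<in> FIN_omega \<and> unions (X n) \<in> H) \<longrightarrow>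
        (\<exists>Y\<in>FIN_omega. unions Y \<in> H \<and>
           (\<forall>n. finite {i. member Y i \<notin> unions (X n)})))"


section \<open>The partial order of conditions\<close>

text \<open>\<open>2 = {0, 1}\<close> is rendered as \<open>bool\<close>, and a function on \<open>Pow {..<l}\<close> is an extensional one.\<close>

definition two_pow :: "nat \<Rightarrow> (nat set \<Rightarrow> bool) set" where
  "two_pow l = (Pow {..<l} \<rightarrow>\<^sub>E UNIV)"

definition big :: "nat \<Rightarrow> nat set \<Rightarrow> (nat set \<Rightarrow> bool) set \<Rightarrow> bool" where
  "big k s A \<longleftrightarrow>
     (\<forall>\<sigma>\<in>two_pow k. \<exists>\<tau>\<in>A. \<forall>u\<in>Pow {..<k}. \<sigma> u = \<tau> (u \<union> (s - {Max s})))"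

text \<open>A function with domain \<open>l = {0, \<dots>, l - 1}\<close> is a list of length \<open>l\<close>; inclusion of such functions
  is \<^const>\<open>prefix\<close>.\<close>

type_synonym node = "(nat set \<Rightarrow> bool) list"

definition full_tree :: "node set" where
  "full_tree = {f. \<forall>k<length f. f ! k \<in> two_pow k}"

definition subtree :: "node set \<Rightarrow> bool" where
  "subtree T \<longleftrightarrow> T \<subseteq> full_tree \<and> (\<forall>f\<in>T. \<forall>g. prefix g f \<longrightarrow> g \<in> T)"

definition Lev :: "node set \<Rightarrow> nat \<Rightarrow> node set" where
  "Lev T n = {f \<in> T. length f = n}"

definition succs :: "node set \<Rightarrow> node \<Rightarrow> (nat set \<Rightarrow> bool) set" where
  "succs T f = {\<sigma>. f @ [\<sigma>] \<in> T}"

definition Hset :: "node set \<Rightarrow> nat \<Rightarrow> nat set set" where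
  "Hset T k = {s \<in> FIN. k \<le> Max s \<and> (\<forall>f\<in>Lev T (Max s). big k s (succs T f))}"

text \<open>The order on conditions is inclusion.\<close>

definition conditions :: "nat set set set \<Rightarrow> node set set" where
  "conditions H = {T. subtree T \<and> [] \<in> T \<and>
     (\<forall>f\<in>T. \<forall>n\<ge>length f. \<exists>g\<in>T. prefix f g \<and> n \<le> length g) \<and>
     (\<forall>k. Hset T k \<in> H)}"


section \<open>Dense sets\<close>

text \<open>In what follows a forcing notion is a preordered set given by its carrier \<open>P\<close> and its order
  \<open>le\<close>; \<open>le q p\<close> means that \<open>q\<close> is stronger than \<open>p\<close>.\<close>

definition dense_in :: "'p set \<Rightarrow> ('p \<Rightarrow> 'p \<Rightarrow> bool) \<Rightarrow> 'p set \<Rightarrow> bool" where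
  "dense_in P le D \<longleftrightarrow> D \<subseteq> P \<and> (\<forall>p\<in>P. \<exists>d\<in>D. le d p)"

definition dense_below :: "'p set \<Rightarrow> ('p \<Rightarrow> 'p \<Rightarrow> bool) \<Rightarrow> 'p set \<Rightarrow> 'p \<Rightarrow> bool" where
  "dense_below P le D p \<longleftrightarrow> (\<forall>r\<in>P. le r p \<longrightarrow> (\<exists>d\<in>D. le d r))"

definition predense_below :: "'p set \<Rightarrow> ('p \<Rightarrow> 'p \<Rightarrow> bool) \<Rightarrow> 'p set \<Rightarrow> 'p \<Rightarrow> bool" where
  "predense_below P le A q \<longleftrightarrow>
     (\<forall>r\<in>P. le r q \<longrightarrow> (\<exists>a\<in>A. \<exists>t\<in>P. le t r \<and> le t a))"


section \<open>Properness\<close>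

text \<open>First-order formulas in the language of set theory, with variables named by numbers.\<close>

datatype form =
    MemF nat nat
  | EqF nat nat
  | NotF form
  | AndF form form
  | AllF nat form

primrec sat :: "'u set \<Rightarrow> ('u \<Rightarrow> 'u \<Rightarrow> bool) \<Rightarrow> (nat \<Rightarrow> 'u) \<Rightarrow> form \<Rightarrow> bool" where
  "sat U E v (MemF i j) \<longleftrightarrow> E (v i) (v j)"
| "sat U E v (EqF i j) \<longleftrightarrow> v i = v j"
| "sat U E v (NotF \<phi>) \<longleftrightarrow> \<not> sat U E v \<phi>"
| "sat U E v (AndF \<phi> \<psi>) \<longleftrightarrow> sat U E v \<phi> \<and> sat U E v \<psi>"
| "sat U E v (AllF i \<phi>) \<longleftrightarrow> (\<forall>x\<in>U. sat U E (v(i := x)) \<phi>)"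

definition elementary_submodel :: "'u set \<Rightarrow> 'u set \<Rightarrow> ('u \<Rightarrow> 'u \<Rightarrow> bool) \<Rightarrow> bool" where
  "elementary_submodel M U E \<longleftrightarrow> M \<noteq> {} \<and> M \<subseteq> U \<and>
     (\<forall>\<phi> v. (\<forall>i. v i \<in> M) \<longrightarrow> (sat M E v \<phi> \<longleftrightarrow> sat U E v \<phi>))"

definition elems :: "'u set \<Rightarrow> ('u \<Rightarrow> 'u \<Rightarrow> bool) \<Rightarrow> 'u \<Rightarrow> 'u set" where
  "elems U E x = {y \<in> U. E y x}"

text \<open>For regular uncountable \<open>\<theta>\<close>, the structure \<open>(H(\<theta>), \<in>)\<close> is, up to isomorphism, the unique
  well-founded extensional structure \<open>(U, E)\<close> in which the extensions of the elements are precisely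
  the subsets of \<open>U\<close> of cardinality less than \<open>\<theta>\<close> (by the Mostowski collapse and \<open>\<in>\<close>-induction on
  \<open>H(\<theta>)\<close>). Since \<open>\<theta> \<le> |H(\<theta>)|\<close>, there is no loss in taking \<open>\<theta>\<close> to be a cardinal on the type
  of the elements.\<close>

definition is_H :: "'u rel \<Rightarrow> 'u set \<Rightarrow> ('u \<Rightarrow> 'u \<Rightarrow> bool) \<Rightarrow> bool" where
  "is_H \<theta> U E \<longleftrightarrow>
     wf {(y, x). x \<in> U \<and> y \<in> U \<and> E y x} \<and>
     bij_betw (elems U E) U {A. A \<subseteq> U \<and> |A| <o \<theta>}"

text \<open>\<open>z\<close> is the Kuratowski pair of \<open>x\<close> and \<open>y\<close>.\<close>

definition is_pair :: "'u set \<Rightarrow> ('u \<Rightarrow> 'u \<Rightarrow> bool) \<Rightarrow> 'u \<Rightarrow> 'u \<Rightarrow> 'u \<Rightarrow> bool" where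
  "is_pair U E x y z \<longleftrightarrow> z \<in> U \<and>
     (\<exists>a\<in>U. \<exists>b\<in>U. elems U E a = {x} \<and> elems U E b = {x, y} \<and> elems U E z = {a, b})"

text \<open>The element \<open>\<pi>\<close> of \<open>U\<close> is the pair of a set and a binary relation on it that form a copy of
  the forcing notion; \<open>c\<close> maps each condition to its copy.\<close>

definition codes_forcing :: "'u set \<Rightarrow> ('u \<Rightarrow> 'u \<Rightarrow> bool) \<Rightarrow> 'p set \<Rightarrow> ('p \<Rightarrow> 'p \<Rightarrow> bool)
    \<Rightarrow> ('p \<Rightarrow> 'u) \<Rightarrow> 'u \<Rightarrow> bool" where
  "codes_forcing U E P le c \<pi> \<longleftrightarrow>
     inj_on c P \<and> c ` P \<subseteq> U \<and>
     (\<exists>a\<in>U. \<exists>b\<in>U. elems U E a = c ` P \<and>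
        elems U E b = {z. \<exists>p\<in>P. \<exists>q\<in>P. le p q \<and> is_pair U E (c p) (c q) z} \<and>
        is_pair U E a b \<pi>)"

text \<open>\<open>q\<close> is \<open>(M, P)\<close>-generic: for every dense \<open>D \<in> M\<close>, the set \<open>D \<inter> M\<close> is predense below \<open>q\<close>.\<close>

definition generic_condition :: "'u set \<Rightarrow> ('u \<Rightarrow> 'u \<Rightarrow> bool) \<Rightarrow> 'p set \<Rightarrow> ('p \<Rightarrow> 'p \<Rightarrow> bool)
    \<Rightarrow> ('p \<Rightarrow> 'u) \<Rightarrow> 'u set \<Rightarrow> 'p \<Rightarrow> bool" where
  "generic_condition U E P le c M q \<longleftrightarrow>
     (\<forall>d\<in>M. \<forall>D. dense_in P le D \<and> elems U E d = c ` D \<longrightarrow>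
        predense_below P le {r \<in> D. c r \<in> M} q)"

text \<open>Properness: for every regular \<open>\<theta> > 2\<^sup>|\<^sup>P\<^sup>|\<close>, every countable \<open>M \<prec> H(\<theta>)\<close> containing the forcing
  and every condition \<open>p \<in> M\<close>, there is an \<open>(M, P)\<close>-generic \<open>q \<le> p\<close>. The type argument bounds the
  cardinals \<open>\<theta>\<close> under consideration, as \<open>H(\<theta>)\<close> is realised on that type; being proper is the
  assertion for all types.\<close>

definition proper_forcing :: "'u itself \<Rightarrow> 'p set \<Rightarrow> ('p \<Rightarrow> 'p \<Rightarrow> bool) \<Rightarrow> bool" where
  "proper_forcing (_ :: 'u itself) P le \<longleftrightarrow>
     (\<forall>(\<theta> :: 'u rel) U E c \<pi> M.
        Card_order \<theta> \<and> regularCard \<theta> \<and> natLeq <o \<theta> \<and> |Pow P| <o \<theta> \<and>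
        is_H \<theta> U E \<and> codes_forcing U E P le c \<pi> \<and>
        elementary_submodel M U E \<and> countable M \<and> \<pi> \<in> M \<longrightarrow>
        (\<forall>p\<in>P. c p \<in> M \<longrightarrow> (\<exists>q\<in>P. le q p \<and> generic_condition U E P le c M q)))"


section \<open>Names and the forcing relation\<close>

text \<open>A name is a set of pairs of a name and a condition. \<open>Name x C\<close> stands for the set
  \<open>{(x i, s). s \<in> C i}\<close>, and \<open>Void\<close> for the empty name. The index type \<open>nat + 'i\<close> bounds the
  hereditary cardinality of the names, so that all names are obtained when \<open>'i\<close> ranges over all
  types.\<close>

datatype ('i, 'p) pname = Void | Name "nat + 'i \<Rightarrow> ('i, 'p) pname" "nat + 'i \<Rightarrow> 'p set"

primrec pairs :: "('i, 'p) pname \<Rightarrow> (('i, 'p) pname \<times> 'p) set" where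
  "pairs Void = {}"
| "pairs (Name x C) = {(x i, s) | i s. s \<in> C i}"

text \<open>All conditions occurring hereditarily in the name belong to \<open>P\<close>.\<close>

primrec is_name :: "'p set \<Rightarrow> ('i, 'p) pname \<Rightarrow> bool" where
  "is_name P Void \<longleftrightarrow> True"
| "is_name P (Name x C) \<longleftrightarrow> (\<forall>i. C i \<subseteq> P \<and> (C i \<noteq> {} \<longrightarrow> is_name P (x i)))"

text \<open>\<open>p \<tturnstile> x = y\<close>, by recursion on \<open>x\<close>; the symmetric form of the clause is the lemma
  \<open>forces_eq_iff\<close>.\<close>

primrec forces_eq :: "'p set \<Rightarrow> ('p \<Rightarrow> 'p \<Rightarrow> bool) \<Rightarrow> ('i, 'p) pname \<Rightarrow> ('i, 'p) pname
    \<Rightarrow> 'p \<Rightarrow> bool" where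
  "forces_eq P le Void y p \<longleftrightarrow>
     (\<forall>(w, t)\<in>pairs y. \<forall>r\<in>P. \<not> (le r p \<and> le r t))"
| "forces_eq P le (Name x C) y p \<longleftrightarrow>
     (\<forall>i. \<forall>s\<in>C i. \<forall>r\<in>P. le r p \<and> le r s \<longrightarrow>
        dense_below P le {r' \<in> P. \<exists>(w, t)\<in>pairs y. le r' t \<and> forces_eq P le (x i) w r'} r) \<and>
     (\<forall>(w, t)\<in>pairs y. \<forall>r\<in>P. le r p \<and> le r t \<longrightarrow>
        dense_below P le {r' \<in> P. \<exists>i. \<exists>s\<in>C i. le r' s \<and> forces_eq P le (x i) w r'} r)"

definition forces_mem :: "'p set \<Rightarrow> ('p \<Rightarrow> 'p \<Rightarrow> bool) \<Rightarrow> ('i, 'p) pname \<Rightarrow> ('i, 'p) pname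
    \<Rightarrow> 'p \<Rightarrow> bool" where
  "forces_mem P le x y p \<longleftrightarrow>
     dense_below P le {r \<in> P. \<exists>(w, t)\<in>pairs y. le r t \<and> forces_eq P le x w r} p"

lemma forces_eq_iff:
  assumes refl: "\<And>p. p \<in> P \<Longrightarrow> le p p"
  shows "forces_eq P le x y p \<longleftrightarrow>
     (\<forall>(z, s)\<in>pairs x. \<forall>r\<in>P. le r p \<and> le r s \<longrightarrow>
        dense_below P le {r' \<in> P. \<exists>(w, t)\<in>pairs y. le r' t \<and> forces_eq P le z w r'} r) \<and>
     (\<forall>(w, t)\<in>pairs y. \<forall>r\<in>P. le r p \<and> le r t \<longrightarrow>
        dense_below P le {r' \<in> P. \<exists>(z, s)\<in>pairs x. le r' s \<and> forces_eq P le z w r'} r)"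
proof (cases x)
  case Void
  then show ?thesis using refl by (fastforce simp: dense_below_def)
next
  case (Name f C)
  have "(\<exists>i. \<exists>s\<in>C i. le r' s \<and> forces_eq P le (f i) w r') \<longleftrightarrow>
      (\<exists>(z, s)\<in>pairs x. le r' s \<and> forces_eq P le z w r')" for w r'
    unfolding Name by fastforce
  moreover have "(\<forall>i. \<forall>s\<in>C i. Q (f i) s) \<longleftrightarrow> (\<forall>(z, s)\<in>pairs x. Q z s)" for Q
    unfolding Name by fastforce
  ultimately show ?thesis
    unfolding Name forces_eq.simps by simp blast
qed

text \<open>The canonical name \<open>{(x, p). x \<in> set xs \<and> p \<in> P}\<close> of the finite set whose elements are named
  by \<open>xs\<close>. All of \<open>P\<close> is used since \<open>P\<close> need not come with a designated largest condition.\<close>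

definition finset_name :: "'p set \<Rightarrow> ('i, 'p) pname list \<Rightarrow> ('i, 'p) pname" where
  "finset_name P xs =
     Name (case_sum (\<lambda>k. if k < length xs then xs ! k else Void) (\<lambda>_. Void))
          (case_sum (\<lambda>k. if k < length xs then P else {}) (\<lambda>_. {}))"

fun nat_name :: "'p set \<Rightarrow> nat \<Rightarrow> ('i, 'p) pname" where
  "nat_name P n = finset_name P (map (nat_name P) [0..<n])"

declare nat_name.simps [simp del]

definition pair_name :: "'p set \<Rightarrow> ('i, 'p) pname \<Rightarrow> ('i, 'p) pname \<Rightarrow> ('i, 'p) pname" where
  "pair_name P x y = finset_name P [finset_name P [x], finset_name P [x, y]]"

text \<open>\<open>p\<close> forces that \<open>(n, m)\<close> is an element of \<open>f\<close>.\<close>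

definition forces_graph :: "'p set \<Rightarrow> ('p \<Rightarrow> 'p \<Rightarrow> bool) \<Rightarrow> ('i, 'p) pname \<Rightarrow> nat \<Rightarrow> nat
    \<Rightarrow> 'p \<Rightarrow> bool" where
  "forces_graph P le f n m p \<longleftrightarrow>
     forces_mem P le (pair_name P (nat_name P n) (nat_name P m)) f p"

text \<open>\<open>p\<close> forces that \<open>f\<close> is a function from \<open>\<omega>\<close> to \<open>\<omega>\<close>: it is a subset of \<open>\<omega> \<times> \<omega>\<close>, total and
  single-valued. The three conjuncts are the forcing clauses of these statements, where a
  quantifier over \<open>\<omega>\<close> ranges over the canonical names of the natural numbers.\<close>

definition forces_function :: "'p set \<Rightarrow> ('p \<Rightarrow> 'p \<Rightarrow> bool) \<Rightarrow> ('i, 'p) pname \<Rightarrow> 'p \<Rightarrow> bool" where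
  "forces_function P le f p \<longleftrightarrow>
     (\<forall>(z, s)\<in>pairs f. \<forall>r\<in>P. le r p \<and> le r s \<longrightarrow>
        dense_below P le
          {r' \<in> P. \<exists>n m. forces_eq P le z (pair_name P (nat_name P n) (nat_name P m)) r'} r) \<and>
     (\<forall>n. dense_below P le {r \<in> P. \<exists>m. forces_graph P le f n m r} p) \<and>
     (\<forall>n m m'. \<forall>r\<in>P. le r p \<and> forces_graph P le f n m r \<and> forces_graph P le f n m' r \<longrightarrow>
        forces_eq P le (nat_name P m :: ('i, 'p) pname) (nat_name P m') r)"

text \<open>\<open>p\<close> forces that \<open>f(n) \<le> g(n)\<close> for all \<open>n\<close>, where \<open>g\<close> is a function in the ground model.\<close>

definition forces_bounded :: "'p set \<Rightarrow> ('p \<Rightarrow> 'p \<Rightarrow> bool) \<Rightarrow> ('i, 'p) pname \<Rightarrow> (nat \<Rightarrow> nat)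
    \<Rightarrow> 'p \<Rightarrow> bool" where
  "forces_bounded P le f g p \<longleftrightarrow>
     (\<forall>n. dense_below P le {r \<in> P. \<exists>m\<le>g n. forces_graph P le f n m r} p)"

text \<open>Every function from \<open>\<omega>\<close> to \<open>\<omega>\<close> in the generic extension is bounded by one in the ground
  model, i.e. for every name \<open>f\<close>, below each condition forcing \<open>f\<close> to be such a function there is
  one forcing a bound \<open>g\<close>. As for properness, the type argument bounds the size of the names.\<close>

definition omega_omega_bounding :: "'i itself \<Rightarrow> 'p set \<Rightarrow> ('p \<Rightarrow> 'p \<Rightarrow> bool) \<Rightarrow> bool" where
  "omega_omega_bounding (_ :: 'i itself) P le \<longleftrightarrow>
     (\<forall>f :: ('i, 'p) pname. is_name P f \<longrightarrow>
        (\<forall>p\<in>P. forces_function P le f p \<longrightarrow>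
           (\<exists>q\<in>P. le q p \<and> (\<exists>g. forces_bounded P le f g q))))"

end

theory Submission
  imports Defs "HOL-Library.Infinite_Set"
begin

text \<open>Conditions are finitely branching trees, so below a condition \<open>p\<close>, a level \<open>n\<close> and a dense set
  \<open>D\<close> there is a condition with the same nodes up to level \<open>n\<close> that is the union of finitely many
  members of \<open>D\<close>, one for each node of level \<open>n\<close>. Both claims follow if such steps can be iterated
  \<open>\<omega>\<close> times along suitable levels. The limit is a condition because a stable ordered-union
  ultrafilter \<open>H\<close> satisfies a diagonal form of stability, and because \<open>\<langle>k', z\<rangle>\<close>-bigness implies
  \<open>\<langle>k, v \<union> z\<rangle>\<close>-bigness for all \<open>v \<subseteq> k'\<close> disjoint from \<open>k\<close>: only the last block of a union has to be
  controlled.\<close>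

section \<open>Stable ordered-union ultrafilters\<close>

text \<open>Both claims use one fusion relative to a set \<open>N\<close> of conditions closed under
  \<open>restr\<close>. For bounding, \<open>N\<close> consists of the conditions below a given one;
  for properness, it stands for the conditions in a countable elementary submodel, and the dense
  sets are traces on \<open>N\<close>. A finite union of members of \<open>N\<close> need not lie in
  \<open>N\<close>, as a submodel that sees only a copy of the order has no reason to contain it.
  The fusion therefore keeps only restrictions to nodes in \<open>N\<close>, while the fused trees
  are merely conditions. Stability alone allows finitely many exceptional blocks for each n, whereas
  fusion needs each block to be controlled by its predecessor; thinning out with large gaps bridges
  the difference.\<close>

lemma ultrafilter_Int: "ultrafilter_on S H \<Longrightarrow> A \<in> H \<Longrightarrow> B \<in> H \<Longrightarrow> A \<inter> B \<in> H"
  unfolding ultrafilter_on_def by blast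

lemma ultrafilter_mono: "ultrafilter_on S H \<Longrightarrow> A \<in> H \<Longrightarrow> A \<subseteq> B \<Longrightarrow> B \<subseteq> S \<Longrightarrow> B \<in> H"
  unfolding ultrafilter_on_def by blast

lemma ultrafilter_Compl: "ultrafilter_on S H \<Longrightarrow> A \<subseteq> S \<Longrightarrow> A \<in> H \<or> S - A \<in> H"
  by (simp add: ultrafilter_on_def)

lemma ordered_union_obtain:
  assumes "ordered_union_ultrafilter H" "A \<in> H"
  obtains X where "X \<in> FIN_omega" "unions X \<in> H" "unions X \<subseteq> A"
  using assms unfolding ordered_union_ultrafilter_def by blast

lemma ultrafilter_INT:
  assumes "ultrafilter_on S H" "finite I" "I \<noteq> {}" "\<And>i. i \<in> I \<Longrightarrow> A i \<in> H"
  shows "(\<Inter>i\<in>I. A i) \<in> H"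
  using assms(2-4)
  by (induction I rule: finite_ne_induct) (auto intro: ultrafilter_Int[OF assms(1)])

lemma Min_le_Max_FIN: "s \<in> FIN \<Longrightarrow> Min s \<le> Max s"
  by (auto simp: FIN_def)

lemma block_seq_subset: "block_seq X \<Longrightarrow> F \<subseteq> X \<Longrightarrow> F \<noteq> {} \<Longrightarrow> block_seq F"
  unfolding block_seq_def by blast

lemma unionsI: "block_seq X \<Longrightarrow> F \<subseteq> X \<Longrightarrow> finite F \<Longrightarrow> F \<noteq> {} \<Longrightarrow> \<Union>F \<in> unions X"
  unfolding unions_def using block_seq_subset by auto

lemma unionsE:
  assumes "s \<in> unions X"
  obtains F where "F \<subseteq> X" "finite F" "F \<noteq> {}" "s = \<Union>F"
  using assms unfolding unions_def block_seq_def by auto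

lemma unions_superset: "block_seq X \<Longrightarrow> X \<subseteq> unions X"
  using unionsI[of X "{_}"] by auto

lemma unions_Union_closed:
  assumes X: "block_seq X" and F: "finite F" "F \<noteq> {}" "F \<subseteq> unions X"
  shows "\<Union>F \<in> unions X"
proof -
  have "\<forall>s\<in>F. \<exists>G. G \<subseteq> X \<and> finite G \<and> G \<noteq> {} \<and> s = \<Union>G"
    using F(3) by (meson subsetD unionsE)
  then obtain G where G: "\<forall>s\<in>F. G s \<subseteq> X \<and> finite (G s) \<and> G s \<noteq> {} \<and> s = \<Union>(G s)"
    unfolding bchoice_iff by blast
  then have "\<Union>F = (\<Union>s\<in>F. \<Union>(G s))"
    by (intro arg_cong[where f = Union]) (simp add: image_def)
  then have "\<Union>F = \<Union>(\<Union>(G ` F))" by blast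
  moreover have "\<Union>(G ` F) \<subseteq> X" "finite (\<Union>(G ` F))" "\<Union>(G ` F) \<noteq> {}"
    using G F by auto
  ultimately show ?thesis
    using unionsI[OF X] by simp
qed

lemma unions_Un_closed:
  "block_seq X \<Longrightarrow> s \<in> unions X \<Longrightarrow> t \<in> unions X \<Longrightarrow> s \<union> t \<in> unions X"
  using unions_Union_closed[of X "{s, t}"] by simp

lemma block_seq_less_iff:
  assumes X: "block_seq X" and s: "s \<in> X" and t: "t \<in> X"
  shows "s <\<^sub>b t \<longleftrightarrow> Max s < Max t"
proof -
  have "Min s \<le> Max s" "Min t \<le> Max t"
    using assms Min_le_Max_FIN by (auto simp: block_seq_def)
  moreover have "s = t \<or> s <\<^sub>b t \<or> t <\<^sub>b s"
    using assms by (auto simp: block_seq_def)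
  ultimately show ?thesis
    by (auto simp: blt_def)
qed

lemma block_seq_inj_Max: "block_seq X \<Longrightarrow> inj_on Max X"
proof (intro inj_onI)
  fix s t assume "block_seq X" "s \<in> X" "t \<in> X" "Max s = Max t"
  then have "\<not> s <\<^sub>b t" "\<not> t <\<^sub>b s"
    using block_seq_less_iff by auto
  then show "s = t"
    using \<open>block_seq X\<close> \<open>s \<in> X\<close> \<open>t \<in> X\<close> unfolding block_seq_def by blast
qed

lemma FIN_omega_infinite_Max: "X \<in> FIN_omega \<Longrightarrow> infinite (Max ` X)"
  using block_seq_inj_Max[of X] finite_imageD by (auto simp: FIN_omega_def)

lemma FIN_omega_unbounded:
  assumes "X \<in> FIN_omega"
  shows "\<exists>s\<in>X. n \<le> Min s"
proof -
  have X: "block_seq X" "infinite (Max ` X)"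
    using assms FIN_omega_infinite_Max by (auto simp: FIN_omega_def)
  obtain s where s: "s \<in> X" "n \<le> Max s"
    using X(2) unfolding infinite_nat_iff_unbounded_le by blast
  obtain t where t: "t \<in> X" "Max s < Max t"
    using X(2) unfolding infinite_nat_iff_unbounded by blast
  then have "Max s < Min t"
    using block_seq_less_iff[OF X(1) s(1) t(1)] by (simp add: blt_def)
  with s t show ?thesis by force
qed

text \<open>\<open>member\<close> is a definite description, so uniqueness is the point: the number
  of predecessors is finite and strictly increases along the block order. Hence every block of
  \<open>X\<close> has an index.\<close>

lemma member_card:
  assumes X: "block_seq X" and s: "s \<in> X"
  shows "member X (card {t \<in> X. t <\<^sub>b s}) = s"
  unfolding member_def
proof (rule the_equality)
  show "s \<in> X \<and> card {t \<in> X. t <\<^sub>b s} = card {t \<in> X. t <\<^sub>b s}" using s by simp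
next
  have fin: "finite {t \<in> X. t <\<^sub>b u}" if "u \<in> X" for u
  proof -
    have "Max ` {t \<in> X. t <\<^sub>b u} \<subseteq> {..<Max u}"
      using block_seq_less_iff[OF X _ that] by auto
    then have "finite (Max ` {t \<in> X. t <\<^sub>b u})"
      by (rule finite_subset) simp
    moreover have "inj_on Max {t \<in> X. t <\<^sub>b u}"
      by (rule inj_on_subset[OF block_seq_inj_Max[OF X]]) auto
    ultimately show ?thesis
      by (rule finite_imageD)
  qed
  have less: "card {t \<in> X. t <\<^sub>b u} < card {t \<in> X. t <\<^sub>b w}" if "u \<in> X" "w \<in> X" "u <\<^sub>b w" for u w
  proof (rule psubset_card_mono[OF fin[OF that(2)]])
    have "t <\<^sub>b w" if "t \<in> X" "t <\<^sub>b u" for t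
      using that \<open>u \<in> X\<close> \<open>w \<in> X\<close> \<open>u <\<^sub>b w\<close> block_seq_less_iff[OF X] by (meson less_trans)
    moreover have "\<not> u <\<^sub>b u"
      using \<open>u \<in> X\<close> block_seq_less_iff[OF X] by simp
    ultimately show "{t \<in> X. t <\<^sub>b u} \<subset> {t \<in> X. t <\<^sub>b w}" using that by blast
  qed
  fix u assume u: "u \<in> X \<and> card {t \<in> X. t <\<^sub>b u} = card {t \<in> X. t <\<^sub>b s}"
  then have cmp: "u = s \<or> u <\<^sub>b s \<or> s <\<^sub>b u"
    using X s unfolding block_seq_def by blast
  show "u = s"
    using u less[of u s] less[of s u] s cmp by fastforce
qed

text \<open>An index-free form of stability: finitely many bad indices yield finitely many bad
  blocks, as each block is the value of \<open>member\<close> at the number of its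
  predecessors.\<close>

lemma stable_almost_subset:
  assumes H: "stable_ordered_union_ultrafilter H"
    and X: "\<And>n::nat. X n \<in> FIN_omega" "\<And>n. unions (X n) \<in> H"
  shows "\<exists>Y\<in>FIN_omega. unions Y \<in> H \<and> (\<forall>n. finite {s \<in> Y. s \<notin> unions (X n)})"
proof -
  have "\<forall>n. X n \<in> FIN_omega \<and> unions (X n) \<in> H"
    using X by blast
  then have "\<exists>Y\<in>FIN_omega. unions Y \<in> H \<and> (\<forall>n. finite {i. member Y i \<notin> unions (X n)})"
    by (rule H[unfolded stable_ordered_union_ultrafilter_def, THEN conjunct2, THEN spec[of _ X], THEN mp])
  then obtain Y where Y: "Y \<in> FIN_omega" "unions Y \<in> H"
    "\<And>n. finite {i. member Y i \<notin> unions (X n)}"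
    by blast
  have "{s \<in> Y. s \<notin> unions (X n)} \<subseteq> member Y ` {i. member Y i \<notin> unions (X n)}" for n
  proof
    fix s assume s: "s \<in> {s \<in> Y. s \<notin> unions (X n)}"
    then have eq: "member Y (card {t \<in> Y. t <\<^sub>b s}) = s"
      using member_card[of Y s] Y(1) by (simp add: FIN_omega_def)
    have "member Y (card {t \<in> Y. t <\<^sub>b s}) \<in> member Y ` {i. member Y i \<notin> unions (X n)}"
      by (rule imageI) (use s in \<open>simp add: eq\<close>)
    then show "s \<in> member Y ` {i. member Y i \<notin> unions (X n)}"
      by (simp only: eq)
  qed
  then have "finite {s \<in> Y. s \<notin> unions (X n)}" for n
    by (rule finite_surj[OF Y(3)])
  then show ?thesis
    using Y(1,2) by blast
qed

lemma ordered_union_tail: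
  assumes H: "ordered_union_ultrafilter H"
  shows "{s \<in> FIN. n \<le> Min s} \<in> H"
proof (rule ccontr)
  assume "{s \<in> FIN. n \<le> Min s} \<notin> H"
  then have "FIN - {s \<in> FIN. n \<le> Min s} \<in> H"
    using H ultrafilter_Compl[of FIN H "{s \<in> FIN. n \<le> Min s}"]
    by (auto simp: ordered_union_ultrafilter_def)
  then obtain X where X: "X \<in> FIN_omega" "unions X \<subseteq> FIN - {s \<in> FIN. n \<le> Min s}"
    using ordered_union_obtain[OF H] by blast
  obtain s where "s \<in> X" "n \<le> Min s"
    using FIN_omega_unbounded[OF X(1)] by blast
  then show False
    using X unions_superset[of X] by (auto simp: FIN_omega_def)
qed

text \<open>Colour \<open>s\<close> by the parity of the number of its small gaps. If \<open>z\<close> and \<open>z'\<close> are blocks of a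
  homogeneous \<open>Z\<close>, the colour of \<open>z \<union> z'\<close> is the sum of their colours and of the gap
  between them; as some gaps are large, the common colour is even and all gaps are large.\<close>

lemma ordered_union_sparse:
  fixes g :: "nat \<Rightarrow> nat"
  assumes H: "ordered_union_ultrafilter H" and g: "mono g" and A: "A \<in> H"
  shows "\<exists>Z\<in>FIN_omega. unions Z \<in> H \<and> unions Z \<subseteq> A \<and>
    (\<forall>z\<in>Z. \<forall>z'\<in>Z. z <\<^sub>b z' \<longrightarrow> g (Max z) \<le> Min z')"
proof -
  \<comment> \<open>As \<open>g\<close> is monotone, \<open>y\<close> belongs to \<open>C s\<close>
    exactly when it lies below \<open>g\<close> of its predecessor in \<open>s\<close>:
    \<open>C s\<close> collects the right ends of the small gaps.\<close>
  define C where "C s = {y \<in> s. \<exists>x\<in>s. x < y \<and> y < g x}" for s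
  define B where "B = {s \<in> FIN. even (card (C s))}"
  have U: "ultrafilter_on FIN H"
    using H by (simp add: ordered_union_ultrafilter_def)
  have "B \<in> H \<or> FIN - B \<in> H"
    using ultrafilter_Compl[OF U, of B] by (auto simp: B_def)
  then obtain B' b where B': "B' \<in> H" "\<And>s. s \<in> B' \<Longrightarrow> even (card (C s)) = b"
    by (auto simp: B_def)
  obtain Z where Z: "Z \<in> FIN_omega" "unions Z \<in> H" "unions Z \<subseteq> A \<inter> B'"
    using ordered_union_obtain[OF H ultrafilter_Int[OF U A B'(1)]] by blast
  have bs: "block_seq Z" using Z by (simp add: FIN_omega_def)
  have colour: "even (card (C z) + card (C z') + card ({Min z'} \<inter> {y. y < g (Max z)})) = b"
    if z: "z \<in> Z" "z' \<in> Z" "z <\<^sub>b z'" for z z'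
  proof -
    let ?D = "{Min z'} \<inter> {y. y < g (Max z)}"
    have fin: "finite z" "z \<noteq> {}" "finite z'" "z' \<noteq> {}"
      using z bs by (auto simp: block_seq_def FIN_def)
    then have mm: "Max z \<in> z" "Min z' \<in> z'" by auto
    have lt: "x < y" if "x \<in> z" "y \<in> z'" for x y
      using that fin z(3) Max_ge[of z x] Min_le[of z' y] by (simp add: blt_def)
    have "C (z \<union> z') \<subseteq> C z \<union> C z' \<union> ?D"
    proof
      fix y assume "y \<in> C (z \<union> z')"
      then obtain x where y: "y \<in> z \<union> z'" "x \<in> z \<union> z'" "x < y" "y < g x"
        by (auto simp: C_def)
      show "y \<in> C z \<union> C z' \<union> ?D"
      \<comment> \<open>For a pair across the two blocks with \<open>y\<close> above
        \<open>Min z'\<close>, monotonicity gives y < g x \<le> g (Min z'), so \<open>y\<close> is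
        already counted in \<open>C z'\<close>. Only \<open>Min z'\<close> can be new, and it is
        governed by \<open>Max z\<close>.\<close>
      proof (cases "x \<in> z \<and> y \<in> z'")
        case True
        have le: "g x \<le> g (Max z)" "g x \<le> g (Min z')"
          using True fin lt[of x "Min z'"] by (simp_all add: monoD[OF g] less_imp_le)
        show ?thesis
        proof (cases "y = Min z'")
          case False
          then have "Min z' < y" using True fin by (simp add: less_le)
          then have "y \<in> C z'"
            using True le y mm unfolding C_def by fastforce
          then show ?thesis by blast
        next
          case True
          then show ?thesis using le y by simp
        qed
      next
        case False
        moreover have "\<not> (y \<in> z \<and> x \<in> z')"
          using y lt[of y x] by auto
        ultimately have "y \<in> C z \<or> y \<in> C z'"
          using y unfolding C_def by blast
        then show ?thesis by blast
      qed
    qed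
    moreover have "C z \<union> C z' \<union> ?D \<subseteq> C (z \<union> z')"
      using mm lt[of "Max z" "Min z'"] unfolding C_def by blast
    ultimately have "C (z \<union> z') = C z \<union> (C z' \<union> ?D)" by blast
    moreover have "C z \<subseteq> z" "C z' \<subseteq> z'" "?D \<subseteq> z'" "z \<inter> z' = {}"
      using mm lt unfolding C_def by fast+
    then have "C z \<inter> (C z' \<union> ?D) = {}" "finite (C z)" "finite (C z')"
      using fin finite_subset by blast+
    moreover have "Min z' \<notin> C z'"
      using fin by (auto simp: C_def dest: Min_le leD)
    then have "C z' \<inter> ?D = {}" by blast
    ultimately have "card (C (z \<union> z')) = card (C z) + card (C z') + card ?D"
      by (simp add: card_Un_disjoint)
    moreover have "z \<union> z' \<in> B'"
      using z unions_superset[OF bs] unions_Un_closed[OF bs] Z(3) by blast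
    ultimately show ?thesis
      using B'(2)[of "z \<union> z'"] by simp
  qed
  have col1: "even (card (C z)) = b" if "z \<in> Z" for z
    using that B'(2) Z(3) unions_superset[OF bs] by blast
  have b: b
  proof -
    obtain z where z: "z \<in> Z" using bs by (auto simp: block_seq_def)
    obtain z' where z': "z' \<in> Z" "max (Suc (Max z)) (g (Max z)) \<le> Min z'"
      using FIN_omega_unbounded[OF Z(1)] by blast
    then have "{Min z'} \<inter> {y. y < g (Max z)} = {}" "z <\<^sub>b z'"
      by (simp_all add: blt_def)
    then show b
      using colour[OF z z'(1)] col1[OF z] col1[OF z'(1)] by simp
  qed
  have "g (Max z) \<le> Min z'" if "z \<in> Z" "z' \<in> Z" "z <\<^sub>b z'" for z z'
    using colour[OF that] col1[OF that(1)] col1[OF that(2)] b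
    by (cases "Min z' < g (Max z)") simp_all
  then show ?thesis
    using Z by blast
qed

text \<open>Let \<open>Y\<close> be almost contained in every \<open>unions (X n)\<close>, and let
  \<open>g m\<close> lie beyond the minima of all exceptional blocks for n \<le> m. If
  \<open>Z\<close> consists of unions of blocks of \<open>Y\<close> and every z' after z starts at
  or past \<open>g (Max z)\<close>, then no block of \<open>Y\<close> that makes up z' is
  exceptional for n \<le> Max z.\<close>

lemma stable_diagonal:
  assumes H: "stable_ordered_union_ultrafilter H"
    and X: "\<And>n. X n \<in> FIN_omega" "\<And>n. unions (X n) \<in> H"
  shows "\<exists>Z\<in>FIN_omega. unions Z \<in> H \<and>
    (\<forall>z\<in>Z. \<forall>z'\<in>Z. z <\<^sub>b z' \<longrightarrow> (\<forall>n\<le>Max z. z' \<in> unions (X n)))"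
proof -
  have ou: "ordered_union_ultrafilter H"
    using H by (simp add: stable_ordered_union_ultrafilter_def)
  obtain Y where Y: "Y \<in> FIN_omega" "unions Y \<in> H"
    "\<And>n. finite {s \<in> Y. s \<notin> unions (X n)}"
    using stable_almost_subset[OF H, of X] X by blast
  \<comment> \<open>\<open>Suc\<close> puts \<open>g m\<close> strictly above the minima of the
    exceptional blocks; \<open>insert 0\<close> covers the case that there are none.\<close>
  define g where "g m = Max (insert 0 (\<Union>n\<le>m. (\<lambda>s. Suc (Min s)) ` {s \<in> Y. s \<notin> unions (X n)}))" for m
  have g: "y \<in> unions (X n)" if "y \<in> Y" "g m \<le> Min y" "n \<le> m" for y m n
  proof (rule ccontr)
    assume "y \<notin> unions (X n)"
    then have "Suc (Min y) \<le> g m"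
      unfolding g_def using that Y(3) by (intro Max_ge) auto
    then show False using that by simp
  qed
  have "mono g"
  proof (rule monoI)
    fix m m' :: nat assume "m \<le> m'"
    then show "g m \<le> g m'"
      unfolding g_def using Y(3) by (intro Max_mono insert_mono UN_mono) auto
  qed
  note ordered_union_sparse[OF ou this Y(2)]
  then obtain Z where Z: "Z \<in> FIN_omega" "unions Z \<in> H" "unions Z \<subseteq> unions Y"
    "\<And>z z'. z \<in> Z \<Longrightarrow> z' \<in> Z \<Longrightarrow> z <\<^sub>b z' \<Longrightarrow> g (Max z) \<le> Min z'"
    by blast
  have bs: "block_seq Z" "block_seq Y" "\<And>n. block_seq (X n)"
    using Z Y X by (auto simp: FIN_omega_def)
  have "z' \<in> unions (X n)" if z: "z \<in> Z" "z' \<in> Z" "z <\<^sub>b z'" "n \<le> Max z" for z z' n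
  proof -
    have "z' \<in> unions Y"
      using z(2) Z(3) unions_superset[OF bs(1)] by blast
    then obtain F where F: "F \<subseteq> Y" "finite F" "F \<noteq> {}" "z' = \<Union>F"
      by (rule unionsE)
    have "y \<in> unions (X n)" if "y \<in> F" for y
    proof (rule g)
      have "finite z'" "finite y" "y \<noteq> {}"
        using z(2) that F bs by (auto simp: block_seq_def FIN_def)
      then have "Min z' \<le> Min y" using that F by (intro Min_antimono) auto
      then show "g (Max z) \<le> Min y" using Z(4)[OF z(1-3)] by simp
    qed (use that F z in auto)
    then show ?thesis
      using unions_Union_closed[OF bs(3)] F by blast
  qed
  with Z show ?thesis by blast
qed

section \<open>Fusion of conditions\<close>

lemma finite_two_pow: "finite (two_pow l)"
  unfolding two_pow_def by (intro finite_PiE) auto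

lemma finite_Lev:
  assumes "T \<subseteq> full_tree"
  shows "finite (Lev T n)"
proof -
  have "Lev T n \<subseteq> {f. set f \<subseteq> (\<Union>k<n. two_pow k) \<and> length f = n}"
    using assms by (fastforce simp: Lev_def full_tree_def in_set_conv_nth)
  then show ?thesis
    by (rule finite_subset) (auto intro!: finite_lists_length_eq finite_two_pow)
qed

lemma big_mono: "big k s A \<Longrightarrow> A \<subseteq> B \<Longrightarrow> big k s B"
  unfolding big_def by blast

text \<open>Given \<sigma> on the subsets of k, apply the bigness for \<open>z\<close> to w
  \<mapsto> \<sigma>(w \<inter> k) and evaluate at w = u \<union> v. Since v misses k, the
  intersection returns u; since v lies below k' \<le> Max z, the point removed from v \<union> z is
  the last point of z.\<close>

lemma big_Un:
  assumes big: "big k' z A" and z: "z \<in> FIN" "k' \<le> Max z"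
    and v: "v \<subseteq> {..<k'}" "v \<inter> {..<k} = {}" and k: "k \<le> k'"
  shows "big k (v \<union> z) A"
  unfolding big_def
proof
  fix \<sigma> assume \<sigma>: "\<sigma> \<in> two_pow k"
  define \<sigma>' where "\<sigma>' = restrict (\<lambda>w. \<sigma> (w \<inter> {..<k})) (Pow {..<k'})"
  have "\<sigma>' \<in> two_pow k'" by (simp add: \<sigma>'_def two_pow_def)
  with big have "\<exists>\<tau>\<in>A. \<forall>w\<in>Pow {..<k'}. \<sigma>' w = \<tau> (w \<union> (z - {Max z}))"
    unfolding big_def by (rule bspec)
  then obtain \<tau> where \<tau>: "\<tau> \<in> A" "\<And>w. w \<in> Pow {..<k'} \<Longrightarrow> \<sigma>' w = \<tau> (w \<union> (z - {Max z}))"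
    by blast
  have fin: "finite v" "finite z" "z \<noteq> {}"
    using v(1) z(1) finite_subset by (auto simp: FIN_def)
  have "Max (v \<union> z) = Max z"
    using fin v(1) z(2) by (intro Max_eqI) (auto dest: order.strict_trans2 intro: less_imp_le)
  moreover have "Max z \<notin> v" using v(1) z(2) by auto
  ultimately have minus: "v \<union> z - {Max (v \<union> z)} = v \<union> (z - {Max z})" by auto
  have "\<sigma> u = \<tau> (u \<union> (v \<union> z - {Max (v \<union> z)}))" if u: "u \<in> Pow {..<k}" for u
  proof -
    have w: "u \<union> v \<in> Pow {..<k'}" "(u \<union> v) \<inter> {..<k} = u"
      using u v k by auto
    then have "\<sigma> u = \<sigma>' (u \<union> v)" by (simp add: \<sigma>'_def)
    then show ?thesis
      using \<tau>(2)[OF w(1)] by (simp add: minus Un_assoc)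
  qed
  with \<tau>(1) show "\<exists>\<tau>\<in>A. \<forall>u\<in>Pow {..<k}. \<sigma> u = \<tau> (u \<union> (v \<union> z - {Max (v \<union> z)}))"
    by blast
qed

lemma subtree_prefix: "subtree T \<Longrightarrow> f \<in> T \<Longrightarrow> prefix g f \<Longrightarrow> g \<in> T"
  unfolding subtree_def by blast

lemma conditionD:
  assumes "p \<in> conditions H"
  shows "subtree p" "[] \<in> p" "Hset p k \<in> H"
    "f \<in> p \<Longrightarrow> length f \<le> n \<Longrightarrow> \<exists>g\<in>p. prefix f g \<and> n \<le> length g"
  using assms by (auto simp: conditions_def)

lemma condition_extend:
  assumes "p \<in> conditions H" "f \<in> p" "length f \<le> n"
  shows "\<exists>g\<in>p. prefix f g \<and> length g = n"
proof -
  obtain g where g: "g \<in> p" "prefix f g" "n \<le> length g"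
    using conditionD(4)[OF assms] by blast
  have "prefix f (take n g)"
    using g(2) assms(3) by (auto simp: prefix_def)
  moreover have "take n g \<in> p"
    using subtree_prefix[OF conditionD(1)[OF assms(1)] g(1) take_is_prefix] .
  ultimately show ?thesis using g(3) by (intro bexI[of _ "take n g"]) auto
qed

lemma conditionI:
  assumes H: "ultrafilter_on FIN H"
    and T: "subtree T" "[] \<in> T" "\<And>f n. f \<in> T \<Longrightarrow> length f \<le> n \<Longrightarrow> \<exists>g\<in>T. prefix f g \<and> n \<le> length g"
    and A: "\<And>k. \<exists>A\<in>H. A \<subseteq> Hset T k"
  shows "T \<in> conditions H"
proof -
  have "Hset T k \<in> H" for k
  proof -
    obtain A where "A \<in> H" "A \<subseteq> Hset T k" using A by blast
    moreover have "Hset T k \<subseteq> FIN" by (auto simp: Hset_def)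
    ultimately show ?thesis using ultrafilter_mono[OF H] by blast
  qed
  with T show ?thesis unfolding conditions_def by blast
qed

definition restr :: "node set \<Rightarrow> node \<Rightarrow> node set" where
  "restr T f = {g \<in> T. prefix g f \<or> prefix f g}"

lemma restr_subset: "restr T f \<subseteq> T"
  by (auto simp: restr_def)

lemma restr_mono: "S \<subseteq> T \<Longrightarrow> restr S f \<subseteq> restr T f"
  by (auto simp: restr_def)

lemma prefix_total: "prefix f h \<Longrightarrow> prefix g h \<Longrightarrow> prefix f g \<or> prefix g f"
  by (auto simp: prefix_same_cases)

lemma subtree_restr: "subtree T \<Longrightarrow> subtree (restr T f)"
  unfolding subtree_def restr_def
  using prefix_order.trans prefix_total by blast

lemma Hset_transfer:
  assumes "s \<in> Hset T k" "\<And>f. f \<in> Lev S (Max s) \<Longrightarrow> f \<in> T \<and> succs T f \<subseteq> succs S f"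
  shows "s \<in> Hset S k"
  using assms unfolding Hset_def Lev_def by (auto intro: big_mono)

text \<open>Nodes of the restriction of length at least \<open>length f\<close> extend
  \<open>f\<close> and keep all their successors, so bigness survives for every \<open>s\<close>
  with \<open>Min s\<close> at or past \<open>length f\<close>; these \<open>s\<close> form a set in
  \<open>H\<close>.\<close>

lemma restr_condition:
  assumes H: "ordered_union_ultrafilter H" and p: "p \<in> conditions H" and f: "f \<in> p"
  shows "restr p f \<in> conditions H"
proof (rule conditionI)
  show U: "ultrafilter_on FIN H" using H by (simp add: ordered_union_ultrafilter_def)
  show "subtree (restr p f)" by (rule subtree_restr[OF conditionD(1)[OF p]])
  show "[] \<in> restr p f" using conditionD(2)[OF p] by (simp add: restr_def)
next
  fix g n assume g: "g \<in> restr p f" "length g \<le> n"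
  then have gp: "g \<in> p" "prefix g f \<or> prefix f g" by (auto simp: restr_def)
  show "\<exists>h\<in>restr p f. prefix g h \<and> n \<le> length h"
  proof (cases "prefix g f")
    case True
    obtain h where h: "h \<in> p" "prefix f h" "max n (length f) \<le> length h"
      using conditionD(4)[OF p f max.cobounded2] by blast
    then show ?thesis
      using True by (intro bexI[of _ h]) (auto simp: restr_def intro: prefix_order.trans)
  next
    case False
    obtain h where h: "h \<in> p" "prefix g h" "n \<le> length h"
      using conditionD(4)[OF p gp(1) g(2)] by blast
    then show ?thesis
      using False gp(2) by (intro bexI[of _ h]) (auto simp: restr_def intro: prefix_order.trans)
  qed
next
  fix k
  have U: "ultrafilter_on FIN H" using H by (simp add: ordered_union_ultrafilter_def)
  have "Hset p k \<inter> {s \<in> FIN. length f \<le> Min s} \<subseteq> Hset (restr p f) k"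
  proof
    fix s assume s: "s \<in> Hset p k \<inter> {s \<in> FIN. length f \<le> Min s}"
    have len: "length f \<le> Max s"
      using s Min_le_Max_FIN[of s] by auto
    have "g \<in> p \<and> succs p g \<subseteq> succs (restr p f) g" if g: "g \<in> Lev (restr p f) (Max s)" for g
    proof -
      have "prefix f g"
        using g len by (auto simp: Lev_def restr_def prefix_def)
      then show ?thesis
        using g by (auto simp: Lev_def restr_def succs_def)
    qed
    then show "s \<in> Hset (restr p f) k"
      using s Hset_transfer by blast
  qed
  then show "\<exists>A\<in>H. A \<subseteq> Hset (restr p f) k"
    using ultrafilter_Int[OF U conditionD(3)[OF p] ordered_union_tail[OF H]] by blast
qed

text \<open>The last clause asks for restrictions in \<open>N\<close> rather than for
  \<open>p'\<close> itself, since gluing may leave \<open>N\<close>; it supplies the base hypothesis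
  of the next step, which is taken at a higher level. Keeping the nodes of length exactly
  \<open>n\<close> preserves the successor sets at level \<open>n - 1\<close>.\<close>

definition fusion_step :: "nat set set set \<Rightarrow> node set set \<Rightarrow> node set set \<Rightarrow> nat \<Rightarrow> node set \<Rightarrow> node set \<Rightarrow> bool"
  where "fusion_step H N D n p p' \<longleftrightarrow> p' \<in> conditions H \<and> p' \<subseteq> p \<and>
    (\<forall>f. length f \<le> n \<longrightarrow> (f \<in> p' \<longleftrightarrow> f \<in> p)) \<and>
    (\<forall>f\<in>p'. length f = n \<longrightarrow> restr p' f \<in> D) \<and>
    (\<forall>f\<in>p'. n \<le> length f \<longrightarrow> restr p' f \<in> N)"

text \<open>Above each node of level \<open>n\<close> the tree is replaced by a member of
  \<open>D\<close> below the restriction to that node. A level has finitely many nodes, so only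
  finitely many sets \<open>Hset (d f) k\<close> are intersected, and bigness from level
  \<open>n\<close> on is that of the piece containing the node.\<close>

lemma fusion_step_exists:
  assumes H: "ordered_union_ultrafilter H" and p: "p \<in> conditions H"
    and N: "N \<subseteq> conditions H" "\<And>r f. r \<in> N \<Longrightarrow> f \<in> r \<Longrightarrow> restr r f \<in> N"
    and base: "\<And>f. f \<in> p \<Longrightarrow> l \<le> length f \<Longrightarrow> restr p f \<in> N" and l: "l \<le> n"
    and D: "D \<subseteq> N" "\<And>r. r \<in> N \<Longrightarrow> \<exists>d\<in>D. d \<subseteq> r"
  shows "\<exists>p'. fusion_step H N D n p p'"
proof -
  have U: "ultrafilter_on FIN H" using H by (simp add: ordered_union_ultrafilter_def)
  let ?L = "Lev p n"
  have "\<forall>f\<in>?L. \<exists>d. d \<in> D \<and> d \<subseteq> restr p f"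
    using base D(2) l by (fastforce simp: Lev_def)
  then obtain d where d: "\<forall>f\<in>?L. d f \<in> D \<and> d f \<subseteq> restr p f"
    unfolding bchoice_iff by blast
  have dc: "d f \<in> conditions H" if "f \<in> ?L" for f
    using d that D(1) N(1) by blast
  have comp: "prefix g f \<or> prefix f g" "g \<in> p" if "f \<in> ?L" "g \<in> d f" for f g
    using d that by (auto simp: restr_def)
  have above: "f = take n g" if "f \<in> ?L" "g \<in> d f" "n \<le> length g" for f g
    using comp(1)[OF that(1,2)] that(1,3) by (auto simp: Lev_def prefix_def)
  \<comment> \<open>\<open>d f\<close> has nodes of length at least \<open>n\<close>; being
    comparable with \<open>f\<close>, they extend \<open>f\<close>, and hence \<open>f\<close>
    itself lies in \<open>d f\<close>. This is why no node up to level \<open>n\<close> is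
    lost.\<close>
  have top: "f \<in> d f" if f: "f \<in> ?L" for f
  proof -
    obtain g where g: "g \<in> d f" "n \<le> length g"
      using conditionD(4)[OF dc[OF f] conditionD(2)[OF dc[OF f]]] by fastforce
    have "prefix f g"
      using above[OF f g] take_is_prefix by metis
    then show ?thesis
      using subtree_prefix[OF conditionD(1)[OF dc[OF f]] g(1)] by blast
  qed
  define p' where "p' = (\<Union>f\<in>?L. d f)"
  have p'p: "p' \<subseteq> p" using comp(2) by (auto simp: p'_def)
  have p'D: "take n g \<in> ?L" "g \<in> d (take n g)" if g: "g \<in> p'" "n \<le> length g" for g
  proof -
    obtain f where f: "f \<in> ?L" "g \<in> d f" using g(1) by (auto simp: p'_def)
    then show "take n g \<in> ?L" "g \<in> d (take n g)"
      using above[OF f g(2)] by auto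
  qed
  have low: "f \<in> p'" if f: "f \<in> p" "length f \<le> n" for f
  proof -
    obtain g where g: "g \<in> p" "prefix f g" "length g = n"
      using condition_extend[OF p f] by blast
    then have gL: "g \<in> ?L" by (simp add: Lev_def)
    have "f \<in> d g"
      using subtree_prefix[OF conditionD(1)[OF dc[OF gL]] top[OF gL] g(2)] .
    with gL show ?thesis by (auto simp: p'_def)
  qed
  \<comment> \<open>Seen from a node at or above level \<open>n\<close> the glued tree is a single
    piece; that the restrictions lie in \<open>D\<close> and \<open>N\<close> is read off this
    equation.\<close>
  have restr_p': "restr p' g = restr (d (take n g)) g" if g: "g \<in> p'" "n \<le> length g" for g
  proof
    show "restr (d (take n g)) g \<subseteq> restr p' g"
      using p'D(1)[OF g] by (intro restr_mono) (auto simp: p'_def)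
    show "restr p' g \<subseteq> restr (d (take n g)) g"
    proof
      fix h assume "h \<in> restr p' g"
      then have h: "h \<in> p'" "prefix h g \<or> prefix g h" by (auto simp: restr_def)
      have "h \<in> d (take n g)"
      proof (cases "prefix h g")
        case True
        then show ?thesis
          using subtree_prefix[OF conditionD(1)[OF dc[OF p'D(1)[OF g]]] p'D(2)[OF g]] by blast
      next
        case False
        with h(2) have "n \<le> length h" "take n h = take n g"
          using g(2) by (auto simp: prefix_def)
        then show ?thesis using p'D(2)[OF h(1)] by simp
      qed
      with h(2) show "h \<in> restr (d (take n g)) g" by (simp add: restr_def)
    qed
  qed
  have "p' \<in> conditions H"
  proof (rule conditionI[OF U])
    have "subtree (d f)" if "f \<in> ?L" for f using conditionD(1)[OF dc[OF that]] .
    then show "subtree p'" unfolding p'_def subtree_def by blast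
    show "[] \<in> p'" using low conditionD(2)[OF p] by simp
    show "\<exists>g\<in>p'. prefix f g \<and> m \<le> length g" if "f \<in> p'" "length f \<le> m" for f m
    proof -
      obtain h where h: "h \<in> ?L" "f \<in> d h" using \<open>f \<in> p'\<close> by (auto simp: p'_def)
      then show ?thesis
        using conditionD(4)[OF dc[OF h(1)] h(2) that(2)] by (auto simp: p'_def)
    qed
    fix k
    have "?L \<noteq> {}"
      using condition_extend[OF p conditionD(2)[OF p], of n] by (auto simp: Lev_def)
    moreover have "finite ?L"
      using conditionD(1)[OF p] by (intro finite_Lev) (simp add: subtree_def)
    ultimately have "(\<Inter>f\<in>?L. Hset (d f) k) \<inter> {s \<in> FIN. n \<le> Min s} \<in> H"
      using conditionD(3)[OF dc]
      by (intro ultrafilter_Int[OF U] ultrafilter_INT[OF U] ordered_union_tail[OF H])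
    moreover have "(\<Inter>f\<in>?L. Hset (d f) k) \<inter> {s \<in> FIN. n \<le> Min s} \<subseteq> Hset p' k"
    proof
      fix s assume s: "s \<in> (\<Inter>f\<in>?L. Hset (d f) k) \<inter> {s \<in> FIN. n \<le> Min s}"
      then have len: "n \<le> Max s"
        using Min_le_Max_FIN[of s] by auto
      have "big k s (succs p' g)" if g: "g \<in> Lev p' (Max s)" for g
      proof -
        have g': "g \<in> p'" "n \<le> length g" using g len by (auto simp: Lev_def)
        note L = p'D[OF g']
        have "big k s (succs (d (take n g)) g)"
          using s L g by (auto simp: Hset_def Lev_def)
        moreover have "succs (d (take n g)) g \<subseteq> succs p' g"
          using L by (auto simp: succs_def p'_def)
        ultimately show ?thesis by (rule big_mono)
      qed
      moreover have "s \<in> FIN" "k \<le> Max s"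
        using s \<open>?L \<noteq> {}\<close> by (auto simp: Hset_def)
      ultimately show "s \<in> Hset p' k" by (simp add: Hset_def)
    qed
    ultimately show "\<exists>A\<in>H. A \<subseteq> Hset p' k" by blast
  qed
  moreover have "restr p' f \<in> D" if f: "f \<in> p'" "length f = n" for f
  proof -
    have fL: "f \<in> ?L" using p'D(1)[of f] f by simp
    have "restr (d f) f = d f"
      using comp(1)[OF fL] by (auto simp: restr_def)
    then show ?thesis
      using restr_p'[of f] f d fL by simp
  qed
  moreover have "restr p' f \<in> N" if f: "f \<in> p'" "n \<le> length f" for f
    using restr_p'[OF f] p'D[OF f] d D(1) N(2) by auto
  ultimately show ?thesis
    using p'p low unfolding fusion_step_def by blast
qed

text \<open>The conditions \<open>P a\<close> are obtained by fusion steps at the levels listed in \<open>a\<close>. All of them are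
  prepared in advance, so that stability yields one \<open>Z\<close> whose blocks \<open>z\<^sub>i\<^sub>+\<^sub>1\<close> lie in
  \<^term>\<open>Hset (P a) k\<close> for all \<open>a\<close> and \<open>k\<close> bounded by \<open>Max z\<^sub>i + 1\<close>. The fusion is then taken along the
  levels \<open>Max z\<^sub>i + 1\<close>; a union of blocks with last block \<open>z\<^sub>i\<^sub>+\<^sub>1\<close> is handled by \<open>big_Un\<close>.\<close>

lemma fusion:
  assumes H: "stable_ordered_union_ultrafilter H"
    and N: "N \<subseteq> conditions H" "\<And>r f. r \<in> N \<Longrightarrow> f \<in> r \<Longrightarrow> restr r f \<in> N"
    and D: "\<And>n::nat. D n \<subseteq> N" "\<And>n r. r \<in> N \<Longrightarrow> \<exists>d\<in>D n. d \<subseteq> r"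
    and p: "p \<in> N"
  shows "\<exists>q\<in>conditions H. q \<subseteq> p \<and>
    (\<forall>n. \<exists>F\<subseteq>D n. finite F \<and> predense_below (conditions H) (\<subseteq>) F q)"
proof -
  have ou: "ordered_union_ultrafilter H"
    using H by (simp add: stable_ordered_union_ultrafilter_def)
  then have U: "ultrafilter_on FIN H" by (simp add: ordered_union_ultrafilter_def)
  define St where "St j n r r' = fusion_step H N (D j) n r r'" for j n r r'
  \<comment> \<open>The default \<open>r\<close> makes \<open>P\<close> total: a list for which no
    step exists still yields a condition, so \<open>Hset (P a) k\<close> is in \<open>H\<close> for
    every list.\<close>
  define nxt where "nxt n j r = (if \<exists>r'. St j n r r' then SOME r'. St j n r r' else r)" for n j r
  \<comment> \<open>The head of a list is the latest level, and the number of earlier levels selects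
    the dense set.\<close>
  define P where "P = rec_list p (\<lambda>n a r. nxt n (length a) r)"
  have P_simps: "P [] = p" "P (n # a) = nxt n (length a) (P a)" for n a
    by (simp_all add: P_def)
  have nxt: "St j n r (nxt n j r)" if "\<exists>r'. St j n r r'" for j n r
    using that someI_ex[OF that] by (simp add: nxt_def)
  have P_cond: "P a \<in> conditions H" for a
  proof (induction a)
    case Nil
    then show ?case using p N by (auto simp: P_simps)
  next
    case (Cons n a)
    show ?case
    proof (cases "\<exists>r'. St (length a) n (P a) r'")
      case True
      then show ?thesis using nxt[OF True] by (simp add: P_simps St_def fusion_step_def)
    next
      case False
      then show ?thesis using Cons by (simp add: P_simps nxt_def)
    qed
  qed

  \<comment> \<open>The bounds fit n = Max z_i for the i-th block of the final sequence: the levels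
    used up to then are at most n + 1, there are i + 1 \<le> n + 1 of them, and the bigness
    parameter is n + 1. Finiteness of \<open>I n\<close> keeps the intersection in
    \<open>H\<close>.\<close>
  define I where "I n = {a. set a \<subseteq> {..Suc n} \<and> length a \<le> Suc n} \<times> {..Suc n}" for n :: nat
  have "\<exists>X. X \<in> FIN_omega \<and> unions X \<in> H \<and> unions X \<subseteq> (\<Inter>(a, k)\<in>I n. Hset (P a) k)" for n
  proof -
    have "finite (I n)"
      unfolding I_def by (intro finite_cartesian_product finite_lists_length_le) auto
    moreover have "([], 0) \<in> I n" by (simp add: I_def)
    ultimately have "(\<Inter>(a, k)\<in>I n. Hset (P a) k) \<in> H"
      using conditionD(3)[OF P_cond] by (intro ultrafilter_INT[OF U]) auto
    then show ?thesis using ordered_union_obtain[OF ou] by blast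
  qed
  then obtain X where X: "\<And>n. X n \<in> FIN_omega" "\<And>n. unions (X n) \<in> H"
    "\<And>n. unions (X n) \<subseteq> (\<Inter>(a, k)\<in>I n. Hset (P a) k)"
    by metis
  obtain Z where Z: "Z \<in> FIN_omega" "unions Z \<in> H"
    and Zdiag: "\<And>z z' n. z \<in> Z \<Longrightarrow> z' \<in> Z \<Longrightarrow> z <\<^sub>b z' \<Longrightarrow> n \<le> Max z \<Longrightarrow> z' \<in> unions (X n)"
    using stable_diagonal[OF H, of X] X(1,2) by blast
  have bs: "block_seq Z" using Z by (simp add: FIN_omega_def)

  define e where "e = enumerate (Max ` Z)"
  have inf: "infinite (Max ` Z)" by (rule FIN_omega_infinite_Max[OF Z(1)])
  have e_mono: "e i < e j" if "i < j" for i j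
    unfolding e_def using that inf by (rule enumerate_mono)
  define z where "z i = inv_into Z Max (e i)" for i
  have e_in: "e i \<in> Max ` Z" for i
    unfolding e_def using inf by (rule enumerate_in_set)
  have z: "z i \<in> Z" "Max (z i) = e i" for i
    unfolding z_def using e_in[of i] by (auto intro: inv_into_into f_inv_into_f)
  have z_less: "z i <\<^sub>b z j" if "i < j" for i j
    using block_seq_less_iff[OF bs z(1) z(1)] e_mono[OF that] by (simp add: z)
  have z_surj: "\<exists>i. w = z i" if "w \<in> Z" for w
  proof -
    obtain i where "Max w = e i"
      using enumerate_Ex[OF inf imageI[OF \<open>w \<in> Z\<close>]] unfolding e_def by metis
    then have "w = z i"
      using inj_onD[OF block_seq_inj_Max[OF bs]] z \<open>w \<in> Z\<close> by metis
    then show ?thesis ..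
  qed

  \<comment> \<open>One above the maximum of the block: successors of nodes of length
    \<open>e i\<close> are nodes of length \<open>e i + 1\<close>, and the step at this level leaves
    them alone.\<close>
  define m where "m i = Suc (e i)" for i
  have m_mono: "m i < m j" if "i < j" for i j
    using e_mono[OF that] by (simp add: m_def)
  have m_mono': "m i \<le> m j" if "i \<le> j" for i j
    using m_mono[of i j] that by (cases "i = j") auto
  have m_ge: "Suc i \<le> m i" for i
    unfolding m_def e_def using le_enumerate[OF inf, of i] by simp
  define a where "a i = rev (map m [0..<Suc i])" for i
  define r where "r i = P (a i)" for i
  have r_simps: "r 0 = nxt (m 0) 0 p" "r (Suc i) = nxt (m (Suc i)) (Suc i) (r i)" for i
    by (simp_all add: r_def a_def P_simps)
  have r_St: "St i (m i) (if i = 0 then p else r (i - 1)) (r i)" for i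
  proof (induction i)
    case 0
    have "\<exists>r'. St 0 (m 0) p r'"
      unfolding St_def using N D p by (intro fusion_step_exists[OF ou, where l = 0]) auto
    then show ?case using nxt by (simp add: r_simps)
  next
    case (Suc i)
    have "\<exists>r'. St (Suc i) (m (Suc i)) (r i) r'"
      unfolding St_def
    proof (rule fusion_step_exists[OF ou _ N])
      show "r i \<in> conditions H" by (simp add: r_def P_cond)
      show "restr (r i) f \<in> N" if "f \<in> r i" "m i \<le> length f" for f
        using Suc that by (simp add: St_def fusion_step_def)
      show "m i \<le> m (Suc i)" by (rule m_mono') simp
    qed (use D in auto)
    then show ?case using nxt by (simp add: r_simps)
  qed
  have r_cond: "r i \<in> conditions H" for i by (simp add: r_def P_cond)
  have r_agree1: "f \<in> r (Suc i) \<longleftrightarrow> f \<in> r i" if "length f \<le> m (Suc i)" for f i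
    using r_St[of "Suc i"] that by (simp add: St_def fusion_step_def)
  have r_agree: "f \<in> r (i + j) \<longleftrightarrow> f \<in> r i" if "length f \<le> m (Suc i)" for f i j
  proof (induction j)
    case (Suc j)
    have "length f \<le> m (Suc (i + j))"
      using that m_mono'[of "Suc i" "Suc (i + j)"] by simp
    then show ?case using Suc r_agree1 by simp
  qed simp
  have "r (Suc i) \<subseteq> r i" for i
    using r_St[of "Suc i"] by (simp add: St_def fusion_step_def)
  then have r_anti: "r j \<subseteq> r i" if "i \<le> j" for i j
    using lift_Suc_antimono_le[of r] that by blast

  define q where "q = (\<Inter>i. r i)"
  \<comment> \<open>Step j changes only nodes longer than \<open>m j\<close>, so the steps after i
    leave all nodes of length up to \<open>m (Suc i)\<close> as they are.\<close>
  have q_r: "f \<in> q \<longleftrightarrow> f \<in> r i" if f: "length f \<le> m (Suc i)" for f i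
  proof
    assume fi: "f \<in> r i"
    have "f \<in> r j" for j
    proof (cases "i \<le> j")
      case True
      then show ?thesis using r_agree[OF f, of "j - i"] fi by simp
    next
      case False
      then show ?thesis using r_anti[of j i] fi by auto
    qed
    then show "f \<in> q" by (simp add: q_def)
  qed (simp add: q_def)

  have q_cond: "q \<in> conditions H"
  proof (rule conditionI[OF U])
    show "subtree q"
      using conditionD(1)[OF r_cond] unfolding q_def subtree_def by blast
    show "[] \<in> q" using conditionD(2)[OF r_cond] by (simp add: q_def)
    show "\<exists>g\<in>q. prefix f g \<and> n \<le> length g" if f: "f \<in> q" "length f \<le> n" for f n
    proof -
      have "f \<in> r n" using f(1) by (simp add: q_def)
      then obtain g where g: "g \<in> r n" "prefix f g" "length g = n"
        using condition_extend[OF r_cond _ f(2)] by blast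
      moreover have "n \<le> m (Suc n)" using m_ge[of "Suc n"] by simp
      ultimately show ?thesis using q_r[of g n] by (intro bexI[of _ g]) auto
    qed
    fix k
    \<comment> \<open>Starting at or past \<open>m k\<close> forces the last block z_l of
      \<open>s\<close> to have index greater than \<open>k\<close>. So it has a predecessor z_i with
      k \<le> i, and the stage \<open>r i\<close> supplies the bigness.\<close>
    have "unions Z \<inter> {s \<in> FIN. m k \<le> Min s} \<subseteq> Hset q k"
    proof
      fix s assume s: "s \<in> unions Z \<inter> {s \<in> FIN. m k \<le> Min s}"
      then obtain F where F: "F \<subseteq> Z" "finite F" "F \<noteq> {}" "s = \<Union>F"
        using unionsE by blast
      have sfin: "finite s" "s \<noteq> {}" and sFIN: "s \<in> FIN" using s by (auto simp: FIN_def)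
      define l where "l = Max (e -` (Max ` F))"
      have "inj e" using e_mono by (intro linorder_injI) (metis less_irrefl)
      then have fin: "finite (e -` (Max ` F))" using F by (intro finite_vimageI) auto
      moreover have "e -` (Max ` F) \<noteq> {}"
      proof -
        obtain w where w: "w \<in> F" using F(3) by blast
        then obtain i where "w = z i" using z_surj F(1) by blast
        then have "i \<in> e -` (Max ` F)" using w z(2)[of i] by (metis imageI vimageI)
        then show ?thesis by blast
      qed
      ultimately have "l \<in> e -` (Max ` F)" unfolding l_def by (rule Max_in)
      then obtain w where "w \<in> F" "Max w = e l" by auto
      then have zl: "z l \<in> F"
        using inj_onD[OF block_seq_inj_Max[OF bs], of w "z l"] z F(1) by auto
      have others: "i < l" if "z i \<in> F" "i \<noteq> l" for i
      proof -
        have "i \<le> l" unfolding l_def using that(1) fin z(2)[of i] by (intro Max_ge) (auto intro: rev_image_eqI)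
        with that(2) show ?thesis by simp
      qed
      have zfin: "finite (z l)" "z l \<noteq> {}" "z l \<in> FIN"
        using z(1)[of l] bs by (auto simp: block_seq_def FIN_def)
      have "z l \<subseteq> s" using zl F(4) by blast
      then have "Max (z l) \<in> s" using Max_in[OF zfin(1,2)] by blast
      moreover have "m k \<le> Min s" using s by simp
      ultimately have "m k \<le> Max (z l)"
        using Min_le[OF sfin(1)] order.trans by blast
      then have "k < l"
        using m_mono'[of l k] z(2)[of l] by (cases "k < l") (auto simp: m_def)
      then obtain i where i: "l = Suc i" "k \<le> i" by (cases l) auto
      have zless: "z i <\<^sub>b z l" using z_less i by simp
      have mz: "m i \<le> Max (z l)"
        using e_mono[of i l] z(2)[of l] i(1) by (simp add: m_def)
      define v where "v = s - z l"
      have v: "v \<subseteq> {..<m i}" "v \<inter> {..<k} = {}"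
      proof -
        show "v \<subseteq> {..<m i}"
        proof
          fix x assume "x \<in> v"
          then obtain w where w: "w \<in> F" "x \<in> w" "w \<noteq> z l" using F(4) by (auto simp: v_def)
          obtain j where j: "w = z j" using z_surj w F(1) by blast
          have "j < l" using others[of j] w j by blast
          then have "e j \<le> e i" using e_mono[of j i] i(1) by (cases "j = i") auto
          moreover have "x \<le> Max w"
            using w F(1) bs by (intro Max_ge) (auto simp: block_seq_def FIN_def)
          ultimately show "x \<in> {..<m i}" using j z(2)[of j] by (simp add: m_def)
        qed
        have "k < x" if "x \<in> s" for x
          using that sfin s m_ge[of k] Min_le[of s x] by auto
        then show "v \<inter> {..<k} = {}" by (fastforce simp: v_def)
      qed
      have s_eq: "s = v \<union> z l" using \<open>z l \<subseteq> s\<close> by (auto simp: v_def)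
      \<comment> \<open>The diagonal property for z_i and its successor z_l, at n = Max z_i; the
        history \<open>a i\<close> with the parameter \<open>m i\<close> is among the pairs prepared
        for this n.\<close>
      have "z l \<in> unions (X (e i))"
        using Zdiag[OF z(1) z(1) zless, of "e i"] z(2)[of i] by simp
      moreover have "(a i, m i) \<in> I (e i)"
        using m_mono' m_ge[of i] by (auto simp: I_def a_def m_def less_Suc_eq_le)
      ultimately have zH: "z l \<in> Hset (r i) (m i)"
        using X(3)[of "e i"] by (auto simp: r_def)
      have maxs: "Max s = Max (z l)"
      proof (rule Max_eqI[OF sfin(1)])
        fix x assume "x \<in> s"
        then show "x \<le> Max (z l)"
          using s_eq v(1) mz zfin by auto
      qed (use Max_in[OF zfin(1,2)] \<open>z l \<subseteq> s\<close> in blast)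
      have "big k s (succs q f)" if f: "f \<in> Lev q (Max s)" for f
      proof -
        have len: "length f < m (Suc i)"
          using f maxs z(2)[of l] i(1) by (simp add: Lev_def m_def)
        then have "f \<in> Lev (r i) (Max (z l))"
          using f q_r[of f i] maxs by (simp add: Lev_def)
        then have "big (m i) (z l) (succs (r i) f)"
          using zH by (simp add: Hset_def)
        \<comment> \<open>Here \<open>f\<close> has length \<open>e (Suc i)\<close>, so its
          successors give nodes of length exactly \<open>m (Suc i)\<close>, which are final at stage
          i.\<close>
        moreover have "succs (r i) f = succs q f"
          using q_r[of "f @ [_]" i] len by (simp add: succs_def)
        ultimately have "big (m i) (z l) (succs q f)" by simp
        then show ?thesis
          unfolding s_eq using i(2) m_ge[of i] by (intro big_Un[OF _ zfin(3) mz v]) auto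
      qed
      moreover have "k \<le> Max s"
        using maxs mz i(2) m_ge[of i] by simp
      ultimately show "s \<in> Hset q k"
        using sFIN by (simp add: Hset_def)
    qed
    then show "\<exists>A\<in>H. A \<subseteq> Hset q k"
      using ultrafilter_Int[OF U Z(2) ordered_union_tail[OF ou]] by blast
  qed

  have "\<exists>F\<subseteq>D n. finite F \<and> predense_below (conditions H) (\<subseteq>) F q" for n
  proof (intro exI conjI)
    \<comment> \<open>Step n put these restrictions into \<open>D n\<close>. A condition t \<le> q
      has a node g of length \<open>m n\<close>, and \<open>restr t g\<close> is below both t and
      \<open>restr (r n) g\<close>.\<close>
    let ?F = "restr (r n) ` Lev (r n) (m n)"
    show "?F \<subseteq> D n"
      using r_St[of n] by (auto simp: St_def fusion_step_def Lev_def)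
    show "finite ?F"
      using conditionD(1)[OF r_cond] by (intro finite_imageI finite_Lev) (simp add: subtree_def)
    show "predense_below (conditions H) (\<subseteq>) ?F q"
      unfolding predense_below_def
    proof (intro ballI impI)
      fix t assume t: "t \<in> conditions H" "t \<subseteq> q"
      obtain g where g: "g \<in> t" "length g = m n"
        using condition_extend[OF t(1) conditionD(2)[OF t(1)], of "m n"] by auto
      have tr: "t \<subseteq> r n" using t(2) by (auto simp: q_def)
      then have "restr (r n) g \<in> ?F" using g by (auto simp: Lev_def)
      moreover have "restr t g \<in> conditions H" by (rule restr_condition[OF ou t(1) g(1)])
      ultimately show "\<exists>a\<in>?F. \<exists>u\<in>conditions H. u \<subseteq> t \<and> u \<subseteq> a"
        by (intro bexI[of _ "restr (r n) g"] bexI[of _ "restr t g"] conjI restr_subset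
            restr_mono[OF tr])
    qed
  qed
  moreover have "q \<subseteq> p"
    using r_St[of 0] by (auto simp: q_def St_def fusion_step_def)
  ultimately show ?thesis using q_cond by blast
qed

section \<open>Bounding functions in the generic extension\<close>

lemma forces_graph_mono:
  assumes "forces_graph P le f n m p" "le q p" "\<And>r. le r q \<Longrightarrow> le r p"
  shows "forces_graph P le f n m q"
  using assms unfolding forces_graph_def forces_mem_def dense_below_def by blast

text \<open>\<open>D n\<close> consists of the conditions below \<open>p\<close> that decide the
  value at n; it is dense in \<open>N\<close> because \<open>p\<close> forces the name to be total.
  Fusion leaves finitely many deciding conditions for each n, and \<open>g n\<close> is the largest
  of the values chosen for them.\<close>

lemma conditions_bounding:
  assumes H: "stable_ordered_union_ultrafilter H"
  shows "omega_omega_bounding TYPE('i) (conditions H) (\<subseteq>)"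
  unfolding omega_omega_bounding_def
proof (intro allI impI ballI)
  fix f :: "('i, node set) pname" and p
  assume p: "p \<in> conditions H" and f: "forces_function (conditions H) (\<subseteq>) f p"
  have ou: "ordered_union_ultrafilter H"
    using H by (simp add: stable_ordered_union_ultrafilter_def)
  let ?G = "forces_graph (conditions H) (\<subseteq>) f"
  define N where "N = {r \<in> conditions H. r \<subseteq> p}"
  define D where "D n = {r \<in> N. \<exists>m. ?G n m r}" for n
  have N_restr: "restr r g \<in> N" if "r \<in> N" "g \<in> r" for r g
    using that restr_condition[OF ou] restr_subset[of r g] by (auto simp: N_def)
  have dense: "\<exists>d\<in>D n. d \<subseteq> r" if r: "r \<in> N" for n r
  proof -
    have "dense_below (conditions H) (\<subseteq>) {r \<in> conditions H. \<exists>m. ?G n m r} p"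
      using f unfolding forces_function_def by blast
    then obtain d where "d \<in> conditions H" "\<exists>m. ?G n m d" "d \<subseteq> r"
      using r unfolding dense_below_def N_def by blast
    then show ?thesis using r by (auto simp: D_def N_def)
  qed
  have "\<exists>q\<in>conditions H. q \<subseteq> p \<and>
      (\<forall>n. \<exists>F\<subseteq>D n. finite F \<and> predense_below (conditions H) (\<subseteq>) F q)"
    by (rule fusion[OF H _ N_restr _ dense]) (use p in \<open>auto simp: D_def N_def\<close>)
  then obtain q where q: "q \<in> conditions H" "q \<subseteq> p"
    and F: "\<forall>n. \<exists>F\<subseteq>D n. finite F \<and> predense_below (conditions H) (\<subseteq>) F q"
    by blast
  from F obtain F where F: "\<And>n. F n \<subseteq> D n" "\<And>n. finite (F n)"
    "\<And>n. predense_below (conditions H) (\<subseteq>) (F n) q"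
    by metis
  have "\<forall>n. \<forall>d\<in>F n. \<exists>m. ?G n m d" using F(1) by (auto simp: D_def)
  then obtain v where v: "\<And>n d. d \<in> F n \<Longrightarrow> ?G n (v n d) d" by metis
  define g where "g n = Max (v n ` F n)" for n
  have "\<exists>d\<in>{r \<in> conditions H. \<exists>m\<le>g n. ?G n m r}. d \<subseteq> r"
    if r: "r \<in> conditions H" "r \<subseteq> q" for n r
  proof -
    obtain d t where t: "d \<in> F n" "t \<in> conditions H" "t \<subseteq> r" "t \<subseteq> d"
      using F(3)[of n] r unfolding predense_below_def by blast
    have "?G n (v n d) t"
      using forces_graph_mono[OF v[OF t(1)] t(4)] t(4) by blast
    moreover have "v n d \<le> g n" unfolding g_def using t(1) F(2) by (intro Max_ge) auto
    ultimately show ?thesis using t by blast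
  qed
  then have "forces_bounded (conditions H) (\<subseteq>) f g q"
    by (simp add: forces_bounded_def dense_below_def)
  with q show "\<exists>q\<in>conditions H. q \<subseteq> p \<and> (\<exists>g. forces_bounded (conditions H) (\<subseteq>) f g q)"
    by blast
qed

section \<open>Definability and elementary submodels\<close>

primrec rename :: "(nat \<Rightarrow> nat) \<Rightarrow> form \<Rightarrow> form" where
  "rename f (MemF i j) = MemF (f i) (f j)"
| "rename f (EqF i j) = EqF (f i) (f j)"
| "rename f (NotF \<phi>) = NotF (rename f \<phi>)"
| "rename f (AndF \<phi> \<psi>) = AndF (rename f \<phi>) (rename f \<psi>)"
| "rename f (AllF i \<phi>) = AllF (f i) (rename f \<phi>)"

primrec var_bound :: "form \<Rightarrow> nat" where
  "var_bound (MemF i j) = Suc (max i j)"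
| "var_bound (EqF i j) = Suc (max i j)"
| "var_bound (NotF \<phi>) = var_bound \<phi>"
| "var_bound (AndF \<phi> \<psi>) = max (var_bound \<phi>) (var_bound \<psi>)"
| "var_bound (AllF i \<phi>) = max (Suc i) (var_bound \<phi>)"

text \<open>Bound variables are renamed as well; injectivity prevents capture and makes composition
  commute with the update at a bound variable.\<close>

lemma sat_rename:
  assumes "inj f"
  shows "sat U E v (rename f \<phi>) \<longleftrightarrow> sat U E (v \<circ> f) \<phi>"
proof (induction \<phi> arbitrary: v)
  case (AllF i \<phi>)
  have "(v(f i := x)) \<circ> f = (v \<circ> f)(i := x)" for x
    using assms by (auto simp: fun_eq_iff inj_eq)
  then show ?case unfolding rename.simps sat.simps AllF by simp
qed (simp_all only: rename.simps sat.simps comp_apply)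

lemma sat_cong:
  "(\<And>i. i < var_bound \<phi> \<Longrightarrow> v i = w i) \<Longrightarrow> sat U E v \<phi> \<longleftrightarrow> sat U E w \<phi>"
proof (induction \<phi> arbitrary: v w)
  case (MemF i j)
  then show ?case by (simp add: less_Suc_eq_le)
next
  case (EqF i j)
  then show ?case by (simp add: less_Suc_eq_le)
next
  case (NotF \<phi>)
  then show ?case by (metis sat.simps(3) var_bound.simps(3))
next
  case (AndF \<phi> \<psi>)
  have "sat U E v \<phi> \<longleftrightarrow> sat U E w \<phi>" "sat U E v \<psi> \<longleftrightarrow> sat U E w \<psi>"
    using AndF.prems by (intro AndF.IH; simp)+
  then show ?case by simp
next
  case (AllF i \<phi>)
  have "sat U E (v(i := x)) \<phi> \<longleftrightarrow> sat U E (w(i := x)) \<phi>" for x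
    using AllF.prems by (intro AllF.IH) simp
  then show ?case by simp
qed

text \<open>A semantic notion: definability of a compound predicate follows by introduction rules
  along its shape, without writing down formulas.\<close>

definition definable :: "'u set \<Rightarrow> ('u \<Rightarrow> 'u \<Rightarrow> bool) \<Rightarrow> ((nat \<Rightarrow> 'u) \<Rightarrow> bool) \<Rightarrow> bool" where
  "definable U E Q \<longleftrightarrow> (\<exists>\<phi>. \<forall>v. range v \<subseteq> U \<longrightarrow> (sat U E v \<phi> \<longleftrightarrow> Q v))"

text \<open>Quantified variables are de Bruijn indices: binding \<open>x\<close> turns the assignment \<open>v\<close> into
  \<^term>\<open>case_nat x v\<close>.\<close>

lemma definable_bind:
  assumes "definable U E (\<lambda>w. P (w 0) (\<lambda>n. w (Suc n)))"
  shows "\<exists>\<phi> k. \<forall>v x. range v \<subseteq> U \<longrightarrow> x \<in> U \<longrightarrow> (sat U E (v(k := x)) \<phi> \<longleftrightarrow> P x v)"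
proof -
  obtain \<phi> where \<phi>: "\<And>w. range w \<subseteq> U \<Longrightarrow> sat U E w \<phi> \<longleftrightarrow> P (w 0) (\<lambda>n. w (Suc n))"
    using assms unfolding definable_def by blast
  define k where "k = var_bound \<phi>"
  \<comment> \<open>\<open>k\<close> is a name beyond all variables of \<phi>. The map sends index 0
    to it, shifts 1, ..., k down by one and fixes the rest, which keeps it injective; agreement with
    the de Bruijn assignment is needed only below k.\<close>
  define f where "f j = (if j = 0 then k else if j \<le> k then j - 1 else j)" for j
  have "inj f"
    by (rule injI) (auto simp: f_def split: if_splits)
  have "sat U E (v(k := x)) (rename f \<phi>) \<longleftrightarrow> P x v" if v: "range v \<subseteq> U" "x \<in> U" for v x
  proof -
    have "v i \<in> U" for i using v(1) by (rule subsetD) simp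
    then have "range (case_nat x v) \<subseteq> U" using v(2) by (auto split: nat.splits)
    note \<phi>[OF this]
    moreover have "sat U E (v(k := x)) (rename f \<phi>) \<longleftrightarrow> sat U E (v(k := x) \<circ> f) \<phi>"
      by (rule sat_rename[OF \<open>inj f\<close>])
    moreover have "sat U E (v(k := x) \<circ> f) \<phi> \<longleftrightarrow> sat U E (case_nat x v) \<phi>"
    proof (rule sat_cong)
      fix i assume "i < var_bound \<phi>"
      then show "(v(k := x) \<circ> f) i = case_nat x v i"
        by (cases i) (auto simp: f_def k_def[symmetric])
    qed
    ultimately show ?thesis by simp
  qed
  then show ?thesis by blast
qed

lemma definable_mem: "definable U E (\<lambda>v. E (v i) (v j))"
  unfolding definable_def by (rule exI[of _ "MemF i j"]) simp

lemma definable_eq: "definable U E (\<lambda>v. v i = v j)"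
  unfolding definable_def by (rule exI[of _ "EqF i j"]) simp

lemma definable_not: "definable U E Q \<Longrightarrow> definable U E (\<lambda>v. \<not> Q v)"
  unfolding definable_def by (metis sat.simps(3))

lemma definable_conj:
  "definable U E Q \<Longrightarrow> definable U E R \<Longrightarrow> definable U E (\<lambda>v. Q v \<and> R v)"
  unfolding definable_def by (metis sat.simps(4))

lemma definable_imp:
  assumes "definable U E Q" "definable U E R"
  shows "definable U E (\<lambda>v. Q v \<longrightarrow> R v)"
  using definable_not[OF definable_conj[OF assms(1) definable_not[OF assms(2)]]] by simp

lemma definable_iff:
  assumes "definable U E Q" "definable U E R"
  shows "definable U E (\<lambda>v. Q v \<longleftrightarrow> R v)"
  using definable_conj[OF definable_imp[OF assms] definable_imp[OF assms(2,1)]]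
  by (simp add: iff_conv_conj_imp)

lemma definable_disj:
  assumes "definable U E Q" "definable U E R"
  shows "definable U E (\<lambda>v. Q v \<or> R v)"
  using definable_imp[OF definable_not[OF assms(1)] assms(2)] by (simp add: disj_imp)

lemma definable_ball:
  assumes "definable U E (\<lambda>w. P (w 0) (\<lambda>n. w (Suc n)))"
  shows "definable U E (\<lambda>v. \<forall>x\<in>U. P x v)"
proof -
  obtain \<phi> k where "\<And>v x. range v \<subseteq> U \<Longrightarrow> x \<in> U \<Longrightarrow> sat U E (v(k := x)) \<phi> \<longleftrightarrow> P x v"
    using definable_bind[OF assms] by blast
  then show ?thesis
    unfolding definable_def by (intro exI[of _ "AllF k \<phi>"]) simp
qed

lemma definable_bex:
  assumes "definable U E (\<lambda>w. P (w 0) (\<lambda>n. w (Suc n)))"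
  shows "definable U E (\<lambda>v. \<exists>x\<in>U. P x v)"
  using definable_not[OF definable_ball[where P = "\<lambda>x v. \<not> P x v", OF definable_not[OF assms]]] by simp

lemma definable_cong:
  "definable U E Q \<Longrightarrow> (\<And>v. range v \<subseteq> U \<Longrightarrow> Q v \<longleftrightarrow> R v) \<Longrightarrow> definable U E R"
  unfolding definable_def by metis

lemmas definable_intros = definable_mem definable_eq definable_not definable_conj definable_imp
  definable_iff definable_disj definable_ball definable_bex

text \<open>The Tarski-Vaught argument with three parameters. The formula describes \<open>Q\<close>
  in \<open>U\<close> only: existence is carried down to \<open>M\<close>, and the truth of the
  formula at the witness is carried back up, where it means \<open>Q\<close>.\<close>

lemma elementary_bex:
  assumes M: "elementary_submodel M U E"
    and Q: "definable U E (\<lambda>w. Q (w 0) (w 1) (w 2) (w 3))"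
    and M_in: "a \<in> M" "b \<in> M" "c \<in> M" and ex: "\<exists>x\<in>U. Q x a b c"
  shows "\<exists>x\<in>M. Q x a b c"
proof -
  define v where "v = (\<lambda>n::nat. if n = 0 then a else if n = 1 then b else c)"
  have v: "range v \<subseteq> M" "range v \<subseteq> U"
    using M M_in by (auto simp: v_def elementary_submodel_def)
  have "definable U E (\<lambda>w. (\<lambda>x v. Q x (v 0) (v 1) (v 2)) (w 0) (\<lambda>n. w (Suc n)))"
    using Q by (simp add: numeral_2_eq_2 numeral_3_eq_3)
  from definable_bind[OF this] obtain \<phi> k where
    \<phi>: "\<And>v x. range v \<subseteq> U \<Longrightarrow> x \<in> U \<Longrightarrow> sat U E (v(k := x)) \<phi> \<longleftrightarrow> Q x (v 0) (v 1) (v 2)"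
    by blast
  have "\<not> sat U E v (AllF k (NotF \<phi>))"
    using ex \<phi>[OF v(2)] by (auto simp: v_def)
  then have "\<not> sat M E v (AllF k (NotF \<phi>))"
    using M v(1) unfolding elementary_submodel_def by (metis rangeI subsetD)
  then obtain x where x: "x \<in> M" "sat M E (v(k := x)) \<phi>" by auto
  have "sat U E (v(k := x)) \<phi>"
  proof -
    have "\<forall>i. (v(k := x)) i \<in> M" using v(1) x(1) by auto
    then show ?thesis using M x(2) unfolding elementary_submodel_def by blast
  qed
  then have "Q x a b c"
    using \<phi>[OF v(2), of x] x(1) M by (auto simp: v_def elementary_submodel_def)
  with x(1) show ?thesis by blast
qed

section \<open>Definability of pairs, relations, countability and density\<close>

lemma elems_eq_iff: "A \<subseteq> U \<Longrightarrow> elems U E a = A \<longleftrightarrow> (\<forall>t\<in>U. E t a \<longleftrightarrow> t \<in> A)"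
  by (auto simp: elems_def)

lemma is_pair_iff:
  assumes "x \<in> U" "y \<in> U" "z \<in> U"
  shows "is_pair U E x y z \<longleftrightarrow> (\<exists>a\<in>U. \<exists>b\<in>U. (\<forall>t\<in>U. E t a \<longleftrightarrow> t = x) \<and>
    (\<forall>t\<in>U. E t b \<longleftrightarrow> t = x \<or> t = y) \<and> (\<forall>t\<in>U. E t z \<longleftrightarrow> t = a \<or> t = b))"
  using assms by (simp add: is_pair_def elems_eq_iff cong: bex_cong)

lemma definable_is_pair: "definable U E (\<lambda>v. is_pair U E (v i) (v j) (v k))"
proof (rule definable_cong)
  show "definable U E (\<lambda>v. \<exists>a\<in>U. \<exists>b\<in>U. (\<forall>t\<in>U. E t a \<longleftrightarrow> t = v i) \<and>
      (\<forall>t\<in>U. E t b \<longleftrightarrow> t = v i \<or> t = v j) \<and> (\<forall>t\<in>U. E t (v k) \<longleftrightarrow> t = a \<or> t = b))"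
    by (intro definable_intros)
qed (rule is_pair_iff[symmetric]; auto)

definition rel :: "'u set \<Rightarrow> ('u \<Rightarrow> 'u \<Rightarrow> bool) \<Rightarrow> 'u \<Rightarrow> 'u \<Rightarrow> 'u \<Rightarrow> bool" where
  "rel U E r x y \<longleftrightarrow> (\<exists>z\<in>U. is_pair U E x y z \<and> E z r)"

lemma definable_rel: "definable U E (\<lambda>v. rel U E (v r) (v i) (v j))"
  unfolding rel_def by (intro definable_intros definable_is_pair)

text \<open>Countability without reference to \<open>\<omega>\<close>: \<open>Y\<close> is contained in an orbit of a partial function.\<close>

definition in_orbit :: "'u set \<Rightarrow> ('u \<Rightarrow> 'u \<Rightarrow> bool) \<Rightarrow> 'u \<Rightarrow> 'u \<Rightarrow> 'u \<Rightarrow> bool" where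
  "in_orbit U E Y x0 g \<longleftrightarrow>
     (\<forall>x\<in>U. \<forall>y\<in>U. \<forall>y'\<in>U. rel U E g x y \<and> rel U E g x y' \<longrightarrow> y = y') \<and>
     (\<forall>A\<in>U. E x0 A \<and> (\<forall>x\<in>U. \<forall>y\<in>U. E x A \<and> rel U E g x y \<longrightarrow> E y A) \<longrightarrow>
        (\<forall>z\<in>U. E z Y \<longrightarrow> E z A))"

definition ctbl :: "'u set \<Rightarrow> ('u \<Rightarrow> 'u \<Rightarrow> bool) \<Rightarrow> 'u \<Rightarrow> bool" where
  "ctbl U E Y \<longleftrightarrow> (\<exists>x0\<in>U. \<exists>g\<in>U. in_orbit U E Y x0 g)"

lemma definable_in_orbit: "definable U E (\<lambda>v. in_orbit U E (v i) (v j) (v k))"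
  unfolding in_orbit_def by (intro definable_intros definable_rel)

lemma definable_ctbl: "definable U E (\<lambda>v. ctbl U E (v i))"
  unfolding ctbl_def by (intro definable_intros definable_in_orbit)

definition dense_code :: "'u set \<Rightarrow> ('u \<Rightarrow> 'u \<Rightarrow> bool) \<Rightarrow> 'u \<Rightarrow> 'u \<Rightarrow> 'u \<Rightarrow> bool" where
  "dense_code U E a b D \<longleftrightarrow> (\<forall>d\<in>U. E d D \<longrightarrow> E d a) \<and>
     (\<forall>x\<in>U. E x a \<longrightarrow> (\<exists>d\<in>U. E d D \<and> rel U E b d x))"

lemma definable_dense_code: "definable U E (\<lambda>v. dense_code U E (v i) (v j) (v k))"
  unfolding dense_code_def by (intro definable_intros definable_rel)

text \<open>The hypothesis of \<open>proper_forcingI\<close> on \<open>R\<close>, as a first-order statement about the codes; both the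
  set \<open>N\<close> of conditions and the family of dense sets are read off one countable \<open>X\<close>.\<close>

definition good_code :: "'u set \<Rightarrow> ('u \<Rightarrow> 'u \<Rightarrow> bool) \<Rightarrow> 'u \<Rightarrow> 'u \<Rightarrow> 'u \<Rightarrow> bool" where
  "good_code U E a b R \<longleftrightarrow>
     (\<forall>x\<in>U. E x a \<longrightarrow> (\<exists>Y\<in>U. ctbl U E Y \<and> (\<forall>z\<in>U. rel U E R x z \<longrightarrow> E z Y))) \<and>
     (\<forall>X\<in>U. ctbl U E X \<and>
        (\<forall>x\<in>U. \<forall>z\<in>U. E x X \<and> E x a \<and> rel U E R x z \<longrightarrow> E z X) \<and>
        (\<forall>D\<in>U. E D X \<and> dense_code U E a b D \<longrightarrow>
          (\<forall>x\<in>U. E x X \<and> E x a \<longrightarrow> (\<exists>d\<in>U. E d X \<and> E d D \<and> rel U E b d x))) \<longrightarrow>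
        (\<forall>x\<in>U. E x X \<and> E x a \<longrightarrow> (\<exists>q\<in>U. E q a \<and> rel U E b q x \<and>
          (\<forall>D\<in>U. E D X \<and> dense_code U E a b D \<longrightarrow>
            (\<forall>r\<in>U. E r a \<and> rel U E b r q \<longrightarrow>
              (\<exists>e\<in>U. E e X \<and> E e D \<and> (\<exists>t\<in>U. E t a \<and> rel U E b t r \<and> rel U E b t e)))))))"

lemma definable_good_code: "definable U E (\<lambda>v. good_code U E (v i) (v j) (v k))"
  unfolding good_code_def
  by (intro definable_intros definable_rel definable_ctbl definable_dense_code)

section \<open>Properness\<close>

locale H_structure =
  fixes \<theta> :: "'u rel" and U :: "'u set" and E :: "'u \<Rightarrow> 'u \<Rightarrow> bool"
  assumes uncountable: "natLeq <o \<theta>" and is_H: "is_H \<theta> U E"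
begin

abbreviation "el \<equiv> elems U E"

lemma code_exists: "A \<subseteq> U \<Longrightarrow> |A| <o \<theta> \<Longrightarrow> \<exists>x\<in>U. el x = A"
  using is_H unfolding is_H_def bij_betw_def by (metis (mono_tags, lifting) imageE mem_Collect_eq)

lemma countable_small:
  assumes "countable A"
  shows "|A| <o \<theta>"
proof -
  have "|A| \<le>o |UNIV :: nat set|"
    using assms unfolding countable_def card_of_ordLeq[symmetric] by blast
  then show ?thesis
    using card_of_nat uncountable ordLeq_ordIso_trans ordLeq_ordLess_trans by blast
qed

lemma Times_same_small:
  assumes "|A| <o \<theta>"
  shows "|A \<times> A| <o \<theta>"
proof (cases "finite A")
  case True
  then show ?thesis by (intro countable_small countable_finite) simp
next
  case False
  then show ?thesis
    using ordIso_ordLess_trans[OF card_of_Times_same_infinite assms] by blast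
qed

lemma countable_code_exists: "A \<subseteq> U \<Longrightarrow> countable A \<Longrightarrow> \<exists>x\<in>U. el x = A"
  using code_exists countable_small by blast

text \<open>In a finite universe every subset would be coded, which is impossible by counting.
  Infinity serves to pad countable sets to infinite ones.\<close>

lemma infinite_universe: "infinite U"
proof
  assume fin: "finite U"
  have "Pow U \<subseteq> el ` U"
  proof
    fix A assume "A \<in> Pow U"
    then have "\<exists>x\<in>U. el x = A"
      using fin by (intro countable_code_exists) (auto intro: countable_finite finite_subset)
    then show "A \<in> el ` U" by blast
  qed
  then have "card (Pow U) \<le> card U"
    using fin by (meson card_image_le card_mono finite_imageI order.trans)
  then show False
    using fin less_exp[of "card U"] by (simp add: card_Pow)
qed

lemma pair_exists:
  assumes "x \<in> U" "y \<in> U"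
  shows "\<exists>z\<in>U. is_pair U E x y z"
proof -
  obtain a b where ab: "a \<in> U" "el a = {x}" "b \<in> U" "el b = {x, y}"
    using assms countable_code_exists[of "{x}"] countable_code_exists[of "{x, y}"] by auto
  then obtain z where "z \<in> U" "el z = {a, b}"
    using countable_code_exists[of "{a, b}"] by auto
  with ab show ?thesis by (auto simp: is_pair_def)
qed

lemma is_pair_inject:
  assumes "is_pair U E x y z" "is_pair U E x' y' z"
  shows "x = x' \<and> y = y'"
proof -
  obtain a b a' b' where
    "el a = {x}" "el b = {x, y}" "el z = {a, b}" "el a' = {x'}" "el b' = {x', y'}" "el z = {a', b'}"
    using assms by (auto simp: is_pair_def)
  then have "el a = {x}" "el b = {x, y}" "el a' = {x'}" "el b' = {x', y'}"
    "a = a' \<and> b = b' \<or> a = b' \<and> b = a'"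
    by (auto simp: doubleton_eq_iff)
  then show ?thesis by (auto simp: doubleton_eq_iff)
qed

lemma rel_code_exists:
  assumes S: "S \<subseteq> U \<times> U" "|S| <o \<theta>"
  shows "\<exists>r\<in>U. \<forall>x y. rel U E r x y \<longleftrightarrow> (x, y) \<in> S"
proof -
  have "\<forall>s\<in>S. \<exists>z. z \<in> U \<and> is_pair U E (fst s) (snd s) z"
    using S(1) pair_exists by fastforce
  then obtain f where f: "\<forall>s\<in>S. f s \<in> U \<and> is_pair U E (fst s) (snd s) (f s)"
    unfolding bchoice_iff by blast
  then have "f ` S \<subseteq> U" "|f ` S| <o \<theta>"
    using card_of_image S(2) ordLeq_ordLess_trans by blast+
  then obtain r where r: "r \<in> U" "el r = f ` S"
    using code_exists by blast
  have E_r: "E z r \<longleftrightarrow> z \<in> f ` S" if "z \<in> U" for z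
    using r(2) that by (auto simp: elems_def)
  have "rel U E r x y \<longleftrightarrow> (x, y) \<in> S" for x y
  proof
    assume "rel U E r x y"
    then obtain z where z: "z \<in> U" "is_pair U E x y z" "z \<in> f ` S"
      using E_r by (auto simp: rel_def)
    then obtain s where s: "s \<in> S" "z = f s" by blast
    have "x = fst s \<and> y = snd s"
      using is_pair_inject[OF z(2)] f s by blast
    with s(1) show "(x, y) \<in> S" by simp
  next
    assume "(x, y) \<in> S"
    then have "f (x, y) \<in> U" "is_pair U E x y (f (x, y))" "E (f (x, y)) r"
      using f E_r by auto
    then show "rel U E r x y" unfolding rel_def by blast
  qed
  with r(1) show ?thesis by blast
qed

text \<open>After padding \<open>el Y\<close> with a countably infinite subset of \<open>U\<close>
  there is an injective enumeration h; injectivity makes the shift from h n to h (n + 1)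
  single-valued, and its graph is countable and so has a code.\<close>

lemma countable_imp_ctbl:
  assumes "countable (el Y)"
  shows "ctbl U E Y"
proof -
  obtain C where C: "countable C" "infinite C" "C \<subseteq> U"
    using infinite_countable_subset'[OF infinite_universe] by blast
  define h where "h = from_nat_into (el Y \<union> C)"
  have h: "bij_betw h UNIV (el Y \<union> C)"
    unfolding h_def using assms C by (intro bij_betw_from_nat_into) auto
  have h_in: "h n \<in> U" for n
    using h C(3) by (auto simp: bij_betw_def elems_def)
  have h_inj: "h i = h j \<longleftrightarrow> i = j" for i j
    using h by (auto simp: bij_betw_def inj_eq)
  have "|range (\<lambda>n. (h n, h (Suc n)))| <o \<theta>"
    by (rule countable_small) simp
  then obtain g where g: "g \<in> U" "\<And>x y. rel U E g x y \<longleftrightarrow> (x, y) \<in> range (\<lambda>n. (h n, h (Suc n)))"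
    using rel_code_exists[of "range (\<lambda>n. (h n, h (Suc n)))"] h_in by blast
  have "in_orbit U E Y (h 0) g"
    unfolding in_orbit_def
  proof (intro conjI ballI impI)
    fix x y y' assume "rel U E g x y \<and> rel U E g x y'"
    then show "y = y'" by (auto simp: g(2) h_inj)
  next
    fix A z
    assume A: "E (h 0) A \<and> (\<forall>x\<in>U. \<forall>y\<in>U. E x A \<and> rel U E g x y \<longrightarrow> E y A)"
      and z: "z \<in> U" "E z Y"
    have "E (h n) A" for n
    proof (induction n)
      case (Suc n)
      have "rel U E g (h n) (h (Suc n))" by (auto simp: g(2))
      with Suc A h_in show ?case by blast
    qed (use A in blast)
    moreover have "z \<in> range h" using h z by (auto simp: bij_betw_def elems_def)
    ultimately show "E z A" by blast
  qed
  then show ?thesis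
    unfolding ctbl_def using h_in g(1) by blast
qed

definition orbit :: "'u \<Rightarrow> 'u \<Rightarrow> 'u set" where
  "orbit g x0 = {y. (x0, y) \<in> {(x, y). x \<in> U \<and> y \<in> U \<and> rel U E g x y}\<^sup>*}"

text \<open>\<open>in_orbit\<close> quantifies only over sets coded in \<open>U\<close>. A countable
  orbit is coded, so it can serve as the closed set \<open>A\<close>.\<close>

lemma in_orbit_subset:
  assumes Y: "in_orbit U E Y x0 g" and x0: "x0 \<in> U" and cnt: "countable (orbit g x0)"
  shows "el Y \<subseteq> orbit g x0"
proof -
  let ?S = "{(x, y). x \<in> U \<and> y \<in> U \<and> rel U E g x y}"
  have "orbit g x0 \<subseteq> U"
  proof
    fix y assume "y \<in> orbit g x0"
    then have "(x0, y) \<in> ?S\<^sup>*" by (simp add: orbit_def)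
    then show "y \<in> U" using x0 by (induction rule: rtrancl_induct) auto
  qed
  then obtain A where A: "A \<in> U" "el A = orbit g x0"
    using countable_code_exists cnt by blast
  have E_A: "E z A \<longleftrightarrow> z \<in> orbit g x0" if "z \<in> U" for z
    using A(2) that by (auto simp: elems_def)
  have "E x0 A" using x0 by (simp add: E_A orbit_def)
  moreover have "E y A" if "x \<in> U" "y \<in> U" "E x A" "rel U E g x y" for x y
  proof -
    have "(x0, x) \<in> ?S\<^sup>*" "(x, y) \<in> ?S" using that by (auto simp: E_A orbit_def)
    then have "(x0, y) \<in> ?S\<^sup>*" by (rule rtrancl_into_rtrancl)
    then show ?thesis using that by (simp add: E_A orbit_def)
  qed
  ultimately have "E z A" if "z \<in> U" "E z Y" for z
    using Y A(1) that unfolding in_orbit_def by blast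
  then show ?thesis
    using E_A by (auto simp: elems_def)
qed

lemma ctbl_imp_countable:
  assumes "ctbl U E Y"
  shows "countable (el Y)"
proof -
  obtain x0 g where x0: "x0 \<in> U" "in_orbit U E Y x0 g"
    using assms by (auto simp: ctbl_def)
  define f where "f x = (SOME y. y \<in> U \<and> rel U E g x y)" for x
  have f: "y = f x" if "x \<in> U" "y \<in> U" "rel U E g x y" for x y
  proof -
    have "f x \<in> U \<and> rel U E g x (f x)"
      unfolding f_def by (rule someI[of _ y]) (use that in simp)
    then show ?thesis using x0(2) that unfolding in_orbit_def by blast
  qed
  have "orbit g x0 \<subseteq> range (\<lambda>n. (f ^^ n) x0)"
  proof
    fix y assume "y \<in> orbit g x0"
    then have "(x0, y) \<in> {(x, y). x \<in> U \<and> y \<in> U \<and> rel U E g x y}\<^sup>*" by (simp add: orbit_def)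
    then show "y \<in> range (\<lambda>n. (f ^^ n) x0)"
    proof (induction rule: rtrancl_induct)
      case base
      show ?case by (rule range_eqI[of _ _ 0]) simp
    next
      case (step y z)
      then obtain n where "y = (f ^^ n) x0" by blast
      then show ?case using step f[of y z] by (intro range_eqI[of _ _ "Suc n"]) simp
    qed
  qed
  then have cnt: "countable (orbit g x0)"
    by (rule countable_subset) simp
  show ?thesis
    by (rule countable_subset[OF in_orbit_subset[OF x0(2,1) cnt] cnt])
qed

text \<open>The usual fact that countable elements of an elementary submodel are subsets of it,
  without enumerating by \<omega>: the start \<open>x0\<close> and the map \<open>g\<close> are
  found in \<open>M\<close>, and \<open>M\<close> is closed under \<open>g\<close> because its
  values are unique.\<close>

lemma elementary_ctbl_subset:
  assumes M: "elementary_submodel M U E" "countable M" and Y: "Y \<in> M" "ctbl U E Y"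
  shows "el Y \<subseteq> M"
proof -
  have MU: "M \<subseteq> U" using M(1) by (simp add: elementary_submodel_def)
  have "\<exists>x0\<in>M. \<exists>g\<in>U. in_orbit U E Y x0 g"
    using Y
    by (intro elementary_bex[OF M(1), where Q = "\<lambda>x0 Y _ _. \<exists>g\<in>U. in_orbit U E Y x0 g"]
        definable_intros definable_in_orbit) (auto simp: ctbl_def)
  then obtain x0 where x0: "x0 \<in> M" "\<exists>g\<in>U. in_orbit U E Y x0 g" by blast
  have "\<exists>g\<in>M. in_orbit U E Y x0 g"
    using Y x0
    by (intro elementary_bex[OF M(1), where Q = "\<lambda>g Y x0 _. in_orbit U E Y x0 g"]
        definable_in_orbit)
  then obtain g where g: "g \<in> M" "in_orbit U E Y x0 g" by blast
  have "orbit g x0 \<subseteq> M"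
  proof
    fix y assume "y \<in> orbit g x0"
    then have "(x0, y) \<in> {(x, y). x \<in> U \<and> y \<in> U \<and> rel U E g x y}\<^sup>*" by (simp add: orbit_def)
    then show "y \<in> M"
    proof (induction rule: rtrancl_induct)
      case (step y z)
      have "\<exists>z\<in>U. rel U E g y z" using step(2) by blast
      then have "\<exists>z\<in>M. rel U E g y z"
        by (intro elementary_bex[OF M(1) _ g(1) step(3) step(3), where Q = "\<lambda>z g y _. rel U E g y z"]
            definable_rel)
      then obtain z' where "z' \<in> M" "rel U E g y z'" by blast
      then show ?case
        using g(2) step(2) MU unfolding in_orbit_def by blast
    qed (use x0 in simp)
  qed
  moreover from this have "countable (orbit g x0)"
    using M(2) by (rule countable_subset)
  moreover have "x0 \<in> U" using x0(1) MU by blast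
  ultimately show ?thesis
    using in_orbit_subset[OF g(2)] by blast
qed

end

text \<open>A copy of the forcing in \<open>H(\<theta>)\<close> only remembers its order, so an elementary submodel need not be
  closed under operations such as \<^const>\<open>restr\<close>. By elementarity, however, it contains the code of
  some relation that plays the role of \<open>R\<close>, and it is closed under that one.\<close>

lemma proper_forcingI:
  fixes P :: "'p set" and le :: "'p \<Rightarrow> 'p \<Rightarrow> bool" and R :: "'p \<Rightarrow> 'p set"
  assumes R: "\<And>r. r \<in> P \<Longrightarrow> countable (R r)" "\<And>r. r \<in> P \<Longrightarrow> R r \<subseteq> P"
    and fusion: "\<And>N \<D> p. N \<subseteq> P \<Longrightarrow> (\<And>r. r \<in> N \<Longrightarrow> R r \<subseteq> N) \<Longrightarrow> countable \<D> \<Longrightarrow>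
      (\<And>D. D \<in> \<D> \<Longrightarrow> D \<subseteq> N) \<Longrightarrow> (\<And>D r. D \<in> \<D> \<Longrightarrow> r \<in> N \<Longrightarrow> \<exists>d\<in>D. le d r) \<Longrightarrow> p \<in> N \<Longrightarrow>
      \<exists>q\<in>P. le q p \<and> (\<forall>D\<in>\<D>. predense_below P le D q)"
  shows "proper_forcing TYPE('u) P le"
  unfolding proper_forcing_def
proof (intro allI impI ballI; elim conjE)
  fix \<theta> :: "'u rel" and U E c \<pi> M p
  assume \<theta>: "natLeq <o \<theta>" "is_H \<theta> U E" and P_small: "|Pow P| <o \<theta>"
    and codes: "codes_forcing U E P le c \<pi>"
    and M: "elementary_submodel M U E" "countable M" "\<pi> \<in> M"
    and p: "p \<in> P" "c p \<in> M"
  interpret H_structure \<theta> U E by unfold_locales (fact \<theta>)+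
  have MU: "M \<subseteq> U" using M(1) by (simp add: elementary_submodel_def)
  from codes obtain a b where c: "inj_on c P" "c ` P \<subseteq> U" and ab: "a \<in> U" "b \<in> U" "el a = c ` P"
    and b: "el b = {z. \<exists>p\<in>P. \<exists>q\<in>P. le p q \<and> is_pair U E (c p) (c q) z}"
    and \<pi>: "is_pair U E a b \<pi>"
    unfolding codes_forcing_def by blast
  have E_a: "E x a \<longleftrightarrow> x \<in> c ` P" if "x \<in> U" for x
    using ab(3) that by (auto simp: elems_def)
  have c_U: "c r \<in> U" if "r \<in> P" for r using c(2) that by blast
  have E_ac: "E (c r) a" if "r \<in> P" for r using E_a c_U that by blast
  have c_inj: "c r = c s \<longleftrightarrow> r = s" if "r \<in> P" "s \<in> P" for r s
    using c(1) that by (auto simp: inj_on_eq_iff)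
  have rel_b: "rel U E b (c r) (c s) \<longleftrightarrow> le r s" if rs: "r \<in> P" "s \<in> P" for r s
  proof
    assume "rel U E b (c r) (c s)"
    then obtain z where z: "z \<in> U" "is_pair U E (c r) (c s) z" "z \<in> el b"
      by (auto simp: rel_def elems_def)
    then obtain r' s' where "r' \<in> P" "s' \<in> P" "le r' s'" "is_pair U E (c r') (c s') z"
      using b by auto
    then show "le r s"
      using is_pair_inject[OF z(2)] c_inj rs by metis
  next
    assume "le r s"
    obtain z where z: "z \<in> U" "is_pair U E (c r) (c s) z"
      using pair_exists[OF c_U c_U] rs by blast
    then have "z \<in> el b" using b rs \<open>le r s\<close> by auto
    then show "rel U E b (c r) (c s)"
      using z unfolding rel_def elems_def by blast
  qed

  have "a \<in> M"
  proof -
    have "\<exists>x\<in>M. \<exists>y\<in>U. is_pair U E x y \<pi>"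
      using \<pi> ab M(3)
      by (intro elementary_bex[OF M(1), where Q = "\<lambda>x \<pi> _ _. \<exists>y\<in>U. is_pair U E x y \<pi>"]
          definable_intros definable_is_pair) auto
    then show ?thesis using is_pair_inject[OF \<pi>] by blast
  qed
  have "b \<in> M"
  proof -
    have "\<exists>y\<in>M. is_pair U E a y \<pi>"
      using \<pi> ab M(3) \<open>a \<in> M\<close>
      by (intro elementary_bex[OF M(1), where Q = "\<lambda>y a \<pi> _. is_pair U E a y \<pi>"]
          definable_is_pair) auto
    then show ?thesis using is_pair_inject[OF \<pi>] by blast
  qed

  have "\<exists>S\<in>U. good_code U E a b S"
  proof -
    \<comment> \<open>The graph of \<open>R\<close> on the codes. \<open>P\<close> has size below
      \<theta>, hence so does its square, and the graph has a code.\<close>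
    let ?S = "{(c r, c s) | r s. r \<in> P \<and> s \<in> R r}"
    have P_less: "|c ` P| <o \<theta>"
      by (rule ordLeq_ordLess_trans[OF card_of_image ordLess_transitive[OF card_of_Pow P_small]])
    have sub: "?S \<subseteq> c ` P \<times> c ` P" using R(2) by auto
    moreover have "c ` P \<times> c ` P \<subseteq> U \<times> U" using c(2) by auto
    ultimately have "?S \<subseteq> U \<times> U" by (rule subset_trans)
    moreover have "|?S| <o \<theta>"
      by (rule ordLeq_ordLess_trans[OF card_of_mono1[OF sub] Times_same_small[OF P_less]])
    ultimately have "\<exists>S\<in>U. \<forall>x y. rel U E S x y \<longleftrightarrow> (x, y) \<in> ?S"
      by (rule rel_code_exists)
    then obtain S where S: "S \<in> U" "\<And>x y. rel U E S x y \<longleftrightarrow> (x, y) \<in> ?S"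
      by blast
    have rel_S: "rel U E S (c r) z \<longleftrightarrow> z \<in> c ` R r" if "r \<in> P" for r z
      using that c_inj unfolding S(2) by auto
    have "good_code U E a b S"
      unfolding good_code_def
    proof (intro conjI ballI impI; (elim conjE)?)
      fix x assume x: "x \<in> U" "E x a"
      then obtain r where r: "r \<in> P" "x = c r" using E_a by blast
      have cnt: "countable (c ` R r)" using R(1)[OF r(1)] by simp
      have "c ` R r \<subseteq> U" using R(2)[OF r(1)] c(2) by blast
      then obtain Y where Y: "Y \<in> U" "el Y = c ` R r"
        using countable_code_exists cnt by blast
      have "ctbl U E Y" using countable_imp_ctbl[of Y] Y(2) cnt by simp
      moreover have "E z Y" if "z \<in> U" "rel U E S x z" for z
        using that Y(2) rel_S[OF r(1)] r(2) by (auto simp: elems_def)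
      ultimately show "\<exists>Y\<in>U. ctbl U E Y \<and> (\<forall>z\<in>U. rel U E S x z \<longrightarrow> E z Y)"
        using Y(1) by blast
    next
      fix X x
      assume X: "X \<in> U" "ctbl U E X"
        and X_cl: "\<forall>x\<in>U. \<forall>z\<in>U. E x X \<and> E x a \<and> rel U E S x z \<longrightarrow> E z X"
        and X_dense: "\<forall>D\<in>U. E D X \<and> dense_code U E a b D \<longrightarrow>
          (\<forall>x\<in>U. E x X \<and> E x a \<longrightarrow> (\<exists>d\<in>U. E d X \<and> E d D \<and> rel U E b d x))"
        and x: "x \<in> U" "E x X" "E x a"
      obtain r where r: "r \<in> P" "x = c r" using E_a x by blast
      \<comment> \<open>\<open>X\<close> takes the place of the submodel: each dense set with a code
        in \<open>X\<close> is replaced by its trace on \<open>X\<close>, which is a subset of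
        \<open>N\<close>.\<close>
      define N where "N = {r \<in> P. E (c r) X}"
      define DX where "DX D = {r \<in> P. E (c r) X \<and> E (c r) D}" for D
      define \<D> where "\<D> = DX ` {D \<in> el X. dense_code U E a b D}"
      have "\<exists>q\<in>P. le q r \<and> (\<forall>D\<in>\<D>. predense_below P le D q)"
      proof (rule fusion[of N])
        show "N \<subseteq> P" "r \<in> N" using r x by (auto simp: N_def)
        show "R s \<subseteq> N" if "s \<in> N" for s
        proof
          fix t assume t: "t \<in> R s"
          have s: "s \<in> P" "E (c s) X" using \<open>s \<in> N\<close> by (auto simp: N_def)
          have "t \<in> P" using R(2) s t by blast
          moreover have "rel U E S (c s) (c t)" using rel_S s t by blast
          ultimately show "t \<in> N"
            using X_cl s c_U E_ac by (auto simp: N_def)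
        qed
        have "countable {D \<in> el X. dense_code U E a b D}"
          by (rule countable_subset[OF _ ctbl_imp_countable[OF X(2)]]) auto
        then show "countable \<D>" by (simp add: \<D>_def)
        show "D \<subseteq> N" if "D \<in> \<D>" for D
          using that by (auto simp: \<D>_def DX_def N_def)
        show "\<exists>d\<in>D. le d s" if D: "D \<in> \<D>" and s: "s \<in> N" for D s
        proof -
          obtain D' where D': "D' \<in> U" "E D' X" "dense_code U E a b D'" "D = DX D'"
            using D by (auto simp: \<D>_def elems_def)
          have sP: "s \<in> P" "E (c s) X" using s by (auto simp: N_def)
          then obtain y where y: "y \<in> U" "E y X" "E y D'" "rel U E b y (c s)"
            using X_dense D' c_U E_ac by blast
          have "E y a" using D'(3) y by (simp add: dense_code_def)
          then obtain d where d: "d \<in> P" "y = c d" using E_a y(1) by blast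
          then show ?thesis
            using y rel_b sP(1) by (auto simp: D'(4) DX_def)
        qed
      qed
      then obtain q where q: "q \<in> P" "le q r" "\<And>D. D \<in> \<D> \<Longrightarrow> predense_below P le D q" by blast
      have "\<exists>e\<in>U. E e X \<and> E e D \<and> (\<exists>t\<in>U. E t a \<and> rel U E b t y \<and> rel U E b t e)"
        if D: "D \<in> U" "E D X" "dense_code U E a b D" and y: "y \<in> U" "E y a" "rel U E b y (c q)"
        for D y
      proof -
        obtain s where s: "s \<in> P" "y = c s" using E_a y by blast
        have "DX D \<in> \<D>" using D by (auto simp: \<D>_def elems_def)
        moreover have "le s q" using y(3) s q(1) rel_b by simp
        ultimately obtain d t where "d \<in> DX D" "t \<in> P" "le t s" "le t d"
          using q(3) s(1) unfolding predense_below_def by blast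
        then show ?thesis
          using s c_U E_ac rel_b
          by (intro bexI[of _ "c d"] conjI bexI[of _ "c t"]) (auto simp: DX_def)
      qed
      then show "\<exists>q\<in>U. E q a \<and> rel U E b q x \<and> (\<forall>D\<in>U. E D X \<and> dense_code U E a b D \<longrightarrow>
          (\<forall>r\<in>U. E r a \<and> rel U E b r q \<longrightarrow>
            (\<exists>e\<in>U. E e X \<and> E e D \<and> (\<exists>t\<in>U. E t a \<and> rel U E b t r \<and> rel U E b t e))))"
        using q r c_U E_ac rel_b by (intro bexI[of _ "c q"] conjI) auto
    qed
    with S(1) show ?thesis by blast
  qed
  then have "\<exists>S\<in>M. good_code U E a b S"
    using \<open>a \<in> M\<close> \<open>b \<in> M\<close>
    by (intro elementary_bex[OF M(1), where Q = "\<lambda>S a b _. good_code U E a b S"]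
        definable_good_code)
  then obtain S where S: "S \<in> M" "good_code U E a b S" by blast
  \<comment> \<open>\<open>M\<close> itself is coded, being countable. \<open>X\<close> need not be
    an element of \<open>M\<close>, but \<open>good_code\<close> quantifies over all of
    \<open>U\<close> and so applies to it.\<close>
  obtain X where X: "X \<in> U" "el X = M"
    using countable_code_exists[OF MU M(2)] by blast
  have E_X: "E x X \<longleftrightarrow> x \<in> M" if "x \<in> U" for x
    using X(2) that by (auto simp: elems_def)
  \<comment> \<open>\<open>M\<close> contains a countable \<open>Y\<close> capturing all values of
    \<open>S\<close> at x, and countable elements of \<open>M\<close> are subsets of
    \<open>M\<close>.\<close>
  have closed: "E z X" if x: "x \<in> U" "z \<in> U" "E x X" "E x a" "rel U E S x z" for x z
  proof -
    have "x \<in> M" using x E_X by simp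
    have "\<exists>Y\<in>U. ctbl U E Y \<and> (\<forall>z\<in>U. rel U E S x z \<longrightarrow> E z Y)"
      using S(2) x unfolding good_code_def by blast
    then have "\<exists>Y\<in>M. ctbl U E Y \<and> (\<forall>z\<in>U. rel U E S x z \<longrightarrow> E z Y)"
      using S(1) \<open>x \<in> M\<close>
      by (intro elementary_bex[OF M(1), where
            Q = "\<lambda>Y S x _. ctbl U E Y \<and> (\<forall>z\<in>U. rel U E S x z \<longrightarrow> E z Y)"]
          definable_intros definable_ctbl definable_rel)
    then obtain Y where "Y \<in> M" "ctbl U E Y" "E z Y" using x by blast
    then have "z \<in> M"
      using elementary_ctbl_subset[OF M(1,2)] x(2) by (auto simp: elems_def)
    then show ?thesis using E_X x(2) by simp
  qed
  have meets: "\<exists>d\<in>U. E d X \<and> E d D \<and> rel U E b d x"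
    if D: "D \<in> U" "E D X" "dense_code U E a b D" and x: "x \<in> U" "E x X" "E x a" for D x
  proof -
    have "\<exists>d\<in>U. E d D \<and> rel U E b d x"
      using D(3) x unfolding dense_code_def by blast
    then have "\<exists>d\<in>M. E d D \<and> rel U E b d x"
      using D x E_X \<open>b \<in> M\<close>
      by (intro elementary_bex[OF M(1), where Q = "\<lambda>d D b x. E d D \<and> rel U E b d x"]
          definable_intros definable_rel) simp_all
    then show ?thesis using E_X MU by blast
  qed
  have "ctbl U E X" using countable_imp_ctbl[of X] X(2) M(2) by simp
  then have "ctbl U E X \<and>
      (\<forall>x\<in>U. \<forall>z\<in>U. E x X \<and> E x a \<and> rel U E S x z \<longrightarrow> E z X) \<and>
      (\<forall>D\<in>U. E D X \<and> dense_code U E a b D \<longrightarrow>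
        (\<forall>x\<in>U. E x X \<and> E x a \<longrightarrow> (\<exists>d\<in>U. E d X \<and> E d D \<and> rel U E b d x)))"
    by (intro conjI ballI impI; (elim conjE)?) (assumption | rule closed meets)+
  note good = S(2)[unfolded good_code_def, THEN conjunct2, THEN bspec, OF X(1), THEN mp, OF this]
  have "\<exists>y\<in>U. E y a \<and> rel U E b y (c p) \<and> (\<forall>D\<in>U. E D X \<and> dense_code U E a b D \<longrightarrow>
      (\<forall>r\<in>U. E r a \<and> rel U E b r y \<longrightarrow>
        (\<exists>e\<in>U. E e X \<and> E e D \<and> (\<exists>t\<in>U. E t a \<and> rel U E b t r \<and> rel U E b t e))))"
    by (rule good[THEN bspec, THEN mp]) (use p E_X c_U E_ac in auto)
  then obtain y where y: "y \<in> U" "E y a" "rel U E b y (c p)"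
    and gen: "\<And>D r. D \<in> U \<Longrightarrow> E D X \<Longrightarrow> dense_code U E a b D \<Longrightarrow> r \<in> U \<Longrightarrow> E r a \<Longrightarrow> rel U E b r y \<Longrightarrow>
      \<exists>e\<in>U. E e X \<and> E e D \<and> (\<exists>t\<in>U. E t a \<and> rel U E b t r \<and> rel U E b t e)"
    by blast
  obtain q where q: "q \<in> P" "y = c q" using E_a y by blast
  have "generic_condition U E P le c M q"
    unfolding generic_condition_def predense_below_def
  proof (intro ballI allI impI; elim conjE)
    fix d D r
    assume d: "d \<in> M" "dense_in P le D" "el d = c ` D" and r: "r \<in> P" "le r q"
    have dU: "d \<in> U" using d(1) MU by blast
    have DP: "D \<subseteq> P" using d(2) by (simp add: dense_in_def)
    have E_d: "E x d \<longleftrightarrow> x \<in> c ` D" if "x \<in> U" for x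
      using d(3) that by (auto simp: elems_def)
    have "dense_code U E a b d"
      unfolding dense_code_def
    proof (intro conjI ballI impI)
      show "E x a" if "x \<in> U" "E x d" for x
        using that E_d E_a DP by blast
      fix x assume x: "x \<in> U" "E x a"
      then obtain s where s: "s \<in> P" "x = c s" using E_a by blast
      then obtain t where "t \<in> D" "le t s" using d(2) by (auto simp: dense_in_def)
      then have "c t \<in> U" "E (c t) d" "rel U E b (c t) x"
        using s DP c_U E_d rel_b by auto
      then show "\<exists>d'\<in>U. E d' d \<and> rel U E b d' x" by blast
    qed
    then obtain e t where e: "e \<in> U" "E e X" "E e d" and t: "t \<in> U" "E t a"
      "rel U E b t (c r)" "rel U E b t e"
      using gen[of d "c r"] dU E_X d(1) r q c_U E_ac rel_b by auto
    obtain e' where e': "e' \<in> D" "e = c e'" using e E_d by blast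
    obtain t' where t': "t' \<in> P" "t = c t'" using t E_a by blast
    have "le t' r" "le t' e'" "c e' \<in> M"
      using t t' e e' r DP rel_b E_X by auto
    then show "\<exists>e\<in>{r \<in> D. c r \<in> M}. \<exists>t\<in>P. le t r \<and> le t e"
      using e'(1) t'(1) by blast
  qed
  moreover have "le q p" using y(3) q p(1) rel_b by simp
  ultimately show "\<exists>q\<in>P. le q p \<and> generic_condition U E P le c M q"
    using q(1) by blast
qed

section \<open>Properness of the tree conditions\<close>

lemma countable_full_tree: "countable full_tree"
proof -
  have "full_tree = (\<Union>n. Lev full_tree n)" by (auto simp: Lev_def)
  also have "countable \<dots>"
    by (intro countable_UN) (auto intro: countable_finite finite_Lev)
  finally show ?thesis .
qed

text \<open>\<open>R r\<close> is the set of all restrictions of r, countable because there are only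
  countably many nodes. Closure of \<open>N\<close> under \<open>R\<close> is the closure under
  \<open>restr\<close> that the fusion requires.\<close>

lemma conditions_proper:
  assumes H: "stable_ordered_union_ultrafilter H"
  shows "proper_forcing TYPE('u) (conditions H) (\<subseteq>)"
proof (rule proper_forcingI[where R = "\<lambda>r. restr r ` r"])
  have ou: "ordered_union_ultrafilter H"
    using H by (simp add: stable_ordered_union_ultrafilter_def)
  fix r assume r: "r \<in> conditions H"
  then have "r \<subseteq> full_tree" using conditionD(1) by (auto simp: subtree_def)
  then show "countable (restr r ` r)"
    using countable_full_tree countable_subset by (intro countable_image) blast
  show "restr r ` r \<subseteq> conditions H" using restr_condition[OF ou r] by blast
next
  fix N \<D> p
  assume N: "N \<subseteq> conditions H" "\<And>r. r \<in> N \<Longrightarrow> restr r ` r \<subseteq> N"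
    and \<D>: "countable \<D>" "\<And>D. D \<in> \<D> \<Longrightarrow> D \<subseteq> N" "\<And>D r. D \<in> \<D> \<Longrightarrow> r \<in> N \<Longrightarrow> \<exists>d\<in>D. d \<subseteq> r"
    and p: "p \<in> N"
  show "\<exists>q\<in>conditions H. q \<subseteq> p \<and> (\<forall>D\<in>\<D>. predense_below (conditions H) (\<subseteq>) D q)"
  \<comment> \<open>With no dense sets to meet, \<open>p\<close> itself serves; otherwise the family
    is enumerated by the natural numbers, possibly with repetitions.\<close>
  proof (cases "\<D> = {}")
    case True
    then show ?thesis using p N(1) by blast
  next
    case False
    let ?D = "from_nat_into \<D>"
    have in_\<D>: "?D n \<in> \<D>" for n by (rule from_nat_into[OF False])
    have "\<exists>q\<in>conditions H. q \<subseteq> p \<and>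
        (\<forall>n. \<exists>F\<subseteq>?D n. finite F \<and> predense_below (conditions H) (\<subseteq>) F q)"
      by (rule fusion[OF H N(1) _ \<D>(2)[OF in_\<D>] \<D>(3)[OF in_\<D>] p]) (use N(2) in auto)
    then obtain q where q: "q \<in> conditions H" "q \<subseteq> p"
      "\<And>n. \<exists>F\<subseteq>?D n. finite F \<and> predense_below (conditions H) (\<subseteq>) F q"
      by blast
    have "predense_below (conditions H) (\<subseteq>) D q" if D: "D \<in> \<D>" for D
    proof -
      obtain n where "D = ?D n" using from_nat_into_surj[OF \<D>(1) D] by metis
      then obtain F where "F \<subseteq> D" "predense_below (conditions H) (\<subseteq>) F q"
        using q(3)[of n] by blast
      then show ?thesis unfolding predense_below_def by (meson subsetD)
    qed
    then show ?thesis using q by blast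
  qed
qed

theorem corollary4p2:
  fixes H :: "nat set set set"
  assumes "stable_ordered_union_ultrafilter H"
  shows "proper_forcing TYPE('u) (conditions H) (\<subseteq>) \<and>
         omega_omega_bounding TYPE('i) (conditions H) (\<subseteq>)"
  using conditions_proper[OF assms] conditions_bounding[OF assms] by blast

end
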